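(* Let $n\ge1$ and let $R$ be a finite local commutative ring with residue field $\mathbb{F}_q$ of $q$ elements. Let $\pi_n(\mathcal{MT}_n)$ be the group of permutations of $R^n$ induced by the monoid $\mathcal{MT}_n$. Then: (1) $\pi_n(\mathcal{MT}_n)$ is solvable if and only if $q\le4$; (2) $\pi_n(\mathcal{MT}_n)$ is nilpotent if and only if $q=2$; (3) $\pi_n(\mathcal{MT}_n)$ is abelian if and only if $n=1$ and $R=\mathbb{F}_2$.
   Context: A polynomial $g\in R[x_1,\ldots,x_k]$ is unit-valued if $g(a)\in R^\times$ for all $a\in R^k$. Composition of $n$-tuples of polynomials: $\vec f\circ\vec g=(f_1(g_1,\ldots,g_n),\ldots,f_n(g_1,\ldots,g_n))$. For $n>1$, $\mathcal{MT}_n$ is the monoid under $\circ$ of all tuples $(f_1,f_2+x_2u_2,\ldots,f_n+x_nu_n)$ with $f_1\in R[x_1]$ inducing a bijection of $R$ and, for $2\le i\le n$, $f_i,u_i\in R[x_1,\ldots,x_{i-1}]$ with $u_i$ unit-valued. $\mathcal{MT}_1$ is the monoid of polynomials in $R[x_1]$ inducing a bijection of $R$. $\pi_n$ sends an $n$-tuple of polynomials to the function $R^n\to R^n$ it induces; since $R$ is finite, $\pi_n(\mathcal{MT}_n)$ is a group of permutations of $R^n$ under composition. *)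

theory Defs
  imports "HOL-Algebra.Algebra"
begin

section \<open>Local rings\<close>

definition local_ring :: "('a, 'm) ring_scheme \<Rightarrow> bool"
  where "local_ring R \<longleftrightarrow> cring R \<and> (\<exists>!M. maximalideal M R)"

definition residue_field :: "('a, 'm) ring_scheme \<Rightarrow> 'a set ring"
  where "residue_field R = R Quot (THE M. maximalideal M R)"


section \<open>Polynomials in several variables\<close>

text \<open>The indexed polynomials of HOL-Algebra map a monomial (a multiset of indices) to its
  coefficient, but the library only multiplies them by a variable. The product below is the usual
  convolution: \<^term>\<open>k\<close> ranges over the divisors of the monomial \<^term>\<open>m\<close>.\<close>

definition mpoly_ring :: "('a, 'm) ring_scheme \<Rightarrow> 'i set \<Rightarrow> ('i multiset \<Rightarrow> 'a) ring"
  where "mpoly_ring R I =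
    \<lparr>carrier = ring.indexed_pset R I (carrier R),
     monoid.mult = \<lambda>P Q m. \<Oplus>\<^bsub>R\<^esub>k\<in>{k. k \<subseteq># m}. P k \<otimes>\<^bsub>R\<^esub> Q (m - k),
     one = ring.indexed_const R \<one>\<^bsub>R\<^esub>,
     ring.zero = ring.indexed_const R \<zero>\<^bsub>R\<^esub>,
     ring.add = ring.indexed_padd R\<rparr>"

text \<open>Evaluation of \<^term>\<open>P\<close> at a point \<^term>\<open>a\<close> with coordinates in a ring \<^term>\<open>S\<close>, where the
  coefficients of \<^term>\<open>P\<close> are mapped to \<^term>\<open>S\<close> by \<^term>\<open>h\<close>. Taking a polynomial ring for
  \<^term>\<open>S\<close> gives substitution of polynomials.\<close>

definition mpoly_eval :: "('a, 'm) ring_scheme \<Rightarrow> ('b, 'k) ring_scheme \<Rightarrow> ('a \<Rightarrow> 'b) \<Rightarrow>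
    ('i \<Rightarrow> 'b) \<Rightarrow> ('i multiset \<Rightarrow> 'a) \<Rightarrow> 'b"
  where "mpoly_eval R S h a P =
    (\<Oplus>\<^bsub>S\<^esub>m\<in>{m. P m \<noteq> \<zero>\<^bsub>R\<^esub>}. h (P m) \<otimes>\<^bsub>S\<^esub> (\<Otimes>\<^bsub>S\<^esub>i\<in>set_mset m. a i [^]\<^bsub>S\<^esub> count m i))"

abbreviation mpoly_value :: "('a, 'm) ring_scheme \<Rightarrow> ('i \<Rightarrow> 'a) \<Rightarrow> ('i multiset \<Rightarrow> 'a) \<Rightarrow> 'a"
  where "mpoly_value R a P \<equiv> mpoly_eval R R (\<lambda>c. c) a P"

text \<open>The points of $R^k$, with coordinates numbered from \<open>1\<close> to \<^term>\<open>k\<close>.\<close>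

definition points :: "('a, 'm) ring_scheme \<Rightarrow> nat \<Rightarrow> (nat \<Rightarrow> 'a) set"
  where "points R k = {1..k} \<rightarrow>\<^sub>E carrier R"

definition unit_valued :: "('a, 'm) ring_scheme \<Rightarrow> nat \<Rightarrow> (nat multiset \<Rightarrow> 'a) \<Rightarrow> bool"
  where "unit_valued R k g \<longleftrightarrow> (\<forall>a\<in>points R k. mpoly_value R a g \<in> Units R)"

text \<open>For a polynomial in the single variable with index \<open>1\<close>.\<close>

definition permutation_poly :: "('a, 'm) ring_scheme \<Rightarrow> (nat multiset \<Rightarrow> 'a) \<Rightarrow> bool"
  where "permutation_poly R f \<longleftrightarrow>
    f \<in> carrier (mpoly_ring R {1}) \<and>
    bij_betw (\<lambda>r. mpoly_value R (\<lambda>_. r) f) (carrier R) (carrier R)"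


section \<open>The monoid $\mathcal{MT}_n$ and the permutations it induces\<close>

definition tuple_comp :: "('a, 'm) ring_scheme \<Rightarrow> nat \<Rightarrow> (nat \<Rightarrow> nat multiset \<Rightarrow> 'a) \<Rightarrow>
    (nat \<Rightarrow> nat multiset \<Rightarrow> 'a) \<Rightarrow> nat \<Rightarrow> nat multiset \<Rightarrow> 'a"
  where "tuple_comp R n F G =
    (\<lambda>i\<in>{1..n}. mpoly_eval R (mpoly_ring R {1..n}) (ring.indexed_const R) G (F i))"

text \<open>For \<open>n = 1\<close> the condition on the later entries is vacuous, so that $\mathcal{MT}_1$ consists
  of the polynomials in one variable that induce a bijection of the ring.\<close>

definition MT :: "('a, 'm) ring_scheme \<Rightarrow> nat \<Rightarrow> (nat \<Rightarrow> nat multiset \<Rightarrow> 'a) monoid"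
  where "MT R n =
    \<lparr>carrier = {F \<in> extensional {1..n}.
       permutation_poly R (F 1) \<and>
       (\<forall>i\<in>{2..n}. \<exists>f \<in> carrier (mpoly_ring R {1..i - 1}). \<exists>u \<in> carrier (mpoly_ring R {1..i - 1}).
          unit_valued R (i - 1) u \<and>
          F i = f \<oplus>\<^bsub>mpoly_ring R {1..n}\<^esub> ring.indexed_var R i \<otimes>\<^bsub>mpoly_ring R {1..n}\<^esub> u)},
     monoid.mult = tuple_comp R n,
     one = (\<lambda>i\<in>{1..n}. ring.indexed_var R i)\<rparr>"

definition induced_map :: "('a, 'm) ring_scheme \<Rightarrow> nat \<Rightarrow> (nat \<Rightarrow> nat multiset \<Rightarrow> 'a) \<Rightarrow>
    (nat \<Rightarrow> 'a) \<Rightarrow> nat \<Rightarrow> 'a"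
  where "induced_map R n F = (\<lambda>a\<in>points R n. \<lambda>i\<in>{1..n}. mpoly_value R a (F i))"

definition MT_perms :: "('a, 'm) ring_scheme \<Rightarrow> nat \<Rightarrow> ((nat \<Rightarrow> 'a) \<Rightarrow> nat \<Rightarrow> 'a) monoid"
  where "MT_perms R n =
    (BijGroup (points R n)) \<lparr>carrier := induced_map R n ` carrier (MT R n)\<rparr>"


section \<open>Nilpotent groups\<close>

text \<open>Commutators are written as in \<^const>\<open>derived\<close>.\<close>

primrec lower_central :: "('a, 'm) monoid_scheme \<Rightarrow> nat \<Rightarrow> 'a set"
  where
    "lower_central G 0 = carrier G"
  | "lower_central G (Suc k) = generate G
      (\<Union>h\<in>lower_central G k. \<Union>g\<in>carrier G.
         {h \<otimes>\<^bsub>G\<^esub> g \<otimes>\<^bsub>G\<^esub> inv\<^bsub>G\<^esub> h \<otimes>\<^bsub>G\<^esub> inv\<^bsub>G\<^esub> g})"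

definition nilpotent_group :: "('a, 'm) monoid_scheme \<Rightarrow> bool"
  where "nilpotent_group G \<longleftrightarrow> group G \<and> (\<exists>k. lower_central G k = {\<one>\<^bsub>G\<^esub>})"

end

theory Submission
  imports Defs
begin

text \<open>A chain of ideals in which each successive quotient is a residue field (Nakayama) equips the ring
  with digits that take \<^term>\<open>q\<close> values each. Polynomial functions preserve congruences modulo
  ideals, so with the digits of the coordinates in lexicographic order the maps induced by the monoid
  are triangular: a digit of the image depends only on that digit and the ones before it. On a block of
  points with the same preceding digits such a group permutes at most \<^term>\<open>q\<close> digits, hence it is
  an iterated extension of subgroups of powers of a symmetric group, which is solvable for
  \<^term>\<open>q \<le> 4\<close>. For \<^term>\<open>q = 2\<close> it acts unipotently on the functions to the field with two
  elements: if \<open>t\<close> is the next digit, then \<open>t g - t\<close> depends only on the digits before.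

  Conversely, the symmetric group on the residue classes embeds by translating whole classes, which is
  polynomial because the indicator of a class is; it is not solvable for \<^term>\<open>q \<ge> 5\<close>. For
  \<^term>\<open>q \<ge> 3\<close> there is a unit \<open>u\<close> with \<open>1 - u\<close> a unit, and the commutators of translations with
  the multiplication by \<open>u\<close> are again all translations, so the lower central series does not
  terminate.\<close>

section \<open>Solvability of the symmetric group on four letters\<close>

text \<open>Both upper bounds use only that coordinate \<open>i\<close> of an image is a polynomial
  function of the first \<open>i\<close> coordinates; the bijective first entry and the unit factors
  serve to make the maps permutations. The digits are therefore treated abstractly in
  \<open>digit_group\<close>, with no ring in sight. The bounds on \<open>q\<close> come from a
  single digit: at most four letters have a solvable symmetric group, and a permutation of two
  values is the addition of a constant in the field with two elements. The maps of the converse for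
  solvability and nilpotency change the first coordinate only, so one construction serves every
  \<open>n\<close>. For commutativity, comparing \<open>x + 1\<close> and \<open>u x\<close> at zero
  forces \<open>u = 1\<close> for every unit. As \<open>1 + m\<close> is a unit for \<open>m\<close>
  in the maximal ideal, only \<open>0\<close> and \<open>1\<close> remain. For \<open>n > 1\<close>,
  adding the first coordinate to the second does not commute with translating the first; for
  \<open>n = 1\<close> and two elements there are just two points. Inverses are never written as
  polynomials: finiteness makes them powers.\<close>

context group begin

lemma derived_subset_subgroup:
  assumes "subgroup K G"
    and "\<And>x y. \<lbrakk>x \<in> H; y \<in> H\<rbrakk> \<Longrightarrow> x \<otimes> y \<otimes> inv x \<otimes> inv y \<in> K"
  shows "derived G H \<subseteq> K"
  unfolding derived_def
  by (rule generate_subgroup_incl[OF _ assms(1)]) (use assms(2) in blast)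

text \<open>One more derivation leads from \<open>H\<close> into \<open>K\<close>, so a derived
  series that reaches the trivial group from \<open>K\<close> also reaches it from \<open>H\<close>.
  Only commutators have to be inspected, neither normality nor a quotient.\<close>

lemma solvable_seq_of_commutators:
  assumes "subgroup H G" and "solvable_seq G K"
    and "\<And>x y. \<lbrakk>x \<in> H; y \<in> H\<rbrakk> \<Longrightarrow> x \<otimes> y \<otimes> inv x \<otimes> inv y \<in> K"
  shows "solvable_seq G H"
proof -
  obtain n where n: "(derived G ^^ n) K = {\<one>}"
    using solvable_imp_trivial_derived_seq[OF assms(2)] by blast
  have "derived G H \<subseteq> K"
    using derived_subset_subgroup[OF solvable_imp_subgroup[OF assms(2)] assms(3)] .
  then have "(derived G ^^ Suc n) H \<subseteq> {\<one>}"
    using mono_exp_of_derived[of "derived G H" K n] n by (simp add: funpow_swap1)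
  moreover have "\<one> \<in> (derived G ^^ Suc n) H"
    using exp_of_derived_is_subgroup[OF assms(1)] subgroup.one_closed by blast
  ultimately have "(derived G ^^ Suc n) H = {\<one>}" by blast
  then show ?thesis by (rule trivial_derived_seq_imp_solvable[OF assms(1)])
qed

end

text \<open>A permutation of \<open>{1..4}\<close> is encoded by the list of its four values, so that the derived
  series of the symmetric group can be computed.\<close>

definition comp_word :: "nat list \<Rightarrow> nat list \<Rightarrow> nat list"
  where "comp_word p q = map (\<lambda>i. p ! (i - 1)) q"

text \<open>The inverse sends \<open>i\<close> to the place of \<open>i\<close> in the list.
  \<open>takeWhile\<close> keeps the entries before it, and places are counted from
  \<open>1\<close>.\<close>

definition inv_word :: "nat list \<Rightarrow> nat list"
  where "inv_word p = map (\<lambda>i. Suc (length (takeWhile (\<lambda>x. x \<noteq> i) p))) [1,2,3,4]"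

definition words_S4 :: "nat list list"
  where "words_S4 = filter distinct (List.n_lists 4 [1,2,3,4])"

definition words_V4 :: "nat list list"
  where "words_V4 = [[1,2,3,4],[2,1,4,3],[3,4,1,2],[4,3,2,1]]"

text \<open>The appended words are the 3-cycles, two for each fixed letter.\<close>

definition words_A4 :: "nat list list"
  where "words_A4 = words_V4 @ [[1,3,4,2],[1,4,2,3],[3,2,4,1],[4,2,1,3],
    [2,4,3,1],[4,1,3,2],[2,3,1,4],[3,1,2,4]]"

definition closed_words :: "nat list list \<Rightarrow> bool"
  where "closed_words L \<longleftrightarrow> [1,2,3,4] \<in> set L \<and>
    list_all (\<lambda>p. inv_word p \<in> set L \<and> list_all (\<lambda>q. comp_word p q \<in> set L) L) L"

definition comm_words_in :: "nat list list \<Rightarrow> nat list list \<Rightarrow> bool"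
  where "comm_words_in L L' \<longleftrightarrow> list_all (\<lambda>p. list_all (\<lambda>q.
    comp_word (comp_word (comp_word p q) (inv_word p)) (inv_word q) \<in> set L') L) L"

definition word :: "(nat \<Rightarrow> nat) \<Rightarrow> nat list"
  where "word p = map p [1,2,3,4]"

definition perms_of_words :: "nat list list \<Rightarrow> (nat \<Rightarrow> nat) set"
  where "perms_of_words L = {p. p permutes {1..4} \<and> word p \<in> set L}"

lemma comp_word_map:
  assumes "p permutes {1..4}" "q permutes {1..4::nat}"
  shows "word (p \<circ> q) = comp_word (word p) (word q)"
proof -
  have "q i \<in> {1..4}" if "i \<in> {1..4}" for i using permutes_in_image[OF assms(2)] that by blast
  moreover have "map p [1,2,3,4] ! (j - 1) = p j" if "j \<in> {1..4}" for j
  proof -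
    have "j \<in> {1,2,3,4}" using that by auto
    then show ?thesis by (auto simp: numeral_eq_Suc)
  qed
  ultimately show ?thesis by (simp add: comp_word_def word_def)
qed

lemma inv_word_map:
  assumes "p permutes {1..4::nat}"
  shows "word (inv' p) = inv_word (word p)"
proof -
  have "Suc (length (takeWhile (\<lambda>x. x \<noteq> i) (map p [1,2,3,4]))) = inv' p i" if "i \<in> {1..4}" for i
  proof -
    have "inv' p i \<in> {1..4}" using permutes_in_image[OF permutes_inv[OF assms]] that by blast
    then have "inv' p i \<in> {1,2,3,4}" by auto
    moreover have "p (inv' p i) = i" using permutes_inverses(1)[OF assms] by simp
    moreover have "p j = p k \<longleftrightarrow> j = k" for j k using permutes_inj[OF assms] by (simp add: inj_eq)
    ultimately show ?thesis by auto
  qed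
  then show ?thesis by (simp add: inv_word_def word_def)
qed

lemma words_complete:
  assumes "p permutes {1..4::nat}"
  shows "word p \<in> set words_S4"
proof -
  have "p i \<in> {1,2,3,4}" if "i \<in> {1,2,3,4}" for i
    using permutes_in_image[OF assms, of i] that by auto
  then have "set (word p) \<subseteq> set [1,2,3,4]"
    by (simp only: word_def list.set_map list.set) blast
  moreover have "distinct (word p)"
    using permutes_inj[OF assms] by (simp add: word_def distinct_map inj_eq)
  ultimately show ?thesis
    by (simp add: words_S4_def set_n_lists word_def)
qed

lemma subgroup_perms_of_words:
  assumes "closed_words L"
  shows "subgroup (perms_of_words L) (sym_group 4)"
proof (rule group.subgroupI[OF sym_group_is_group])
  show "perms_of_words L \<subseteq> carrier (sym_group 4)"
    by (auto simp: perms_of_words_def sym_group_carrier)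
  have "id \<in> perms_of_words L"
    using assms by (simp add: perms_of_words_def closed_words_def permutes_id word_def)
  then show "perms_of_words L \<noteq> {}" by blast
next
  fix p assume "p \<in> perms_of_words L"
  then show "inv\<^bsub>sym_group 4\<^esub> p \<in> perms_of_words L"
    using assms unfolding perms_of_words_def
    by (auto simp: sym_group_carrier permutes_inv inv_word_map closed_words_def list_all_iff)
next
  fix p q assume "p \<in> perms_of_words L" "q \<in> perms_of_words L"
  then show "p \<otimes>\<^bsub>sym_group 4\<^esub> q \<in> perms_of_words L"
    using assms unfolding perms_of_words_def
    by (auto simp: sym_group_mult permutes_compose comp_word_map closed_words_def list_all_iff)
qed

lemma commutator_perms_of_words:
  assumes "comm_words_in L L'" "p \<in> perms_of_words L" "q \<in> perms_of_words L"
  shows "p \<otimes>\<^bsub>sym_group 4\<^esub> q \<otimes>\<^bsub>sym_group 4\<^esub> inv\<^bsub>sym_group 4\<^esub> p \<otimes>\<^bsub>sym_group 4\<^esub> inv\<^bsub>sym_group 4\<^esub> q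
    \<in> perms_of_words L'"
  using assms unfolding perms_of_words_def
  by (auto simp: sym_group_mult sym_group_carrier permutes_compose permutes_inv comp_word_map
      inv_word_map comm_words_in_def list_all_iff)

text \<open>The chain identity, Klein four-group, alternating group, symmetric group is climbed from
  below. Each step needs only that the commutators of words of one list lie in the list below it,
  which evaluation decides.\<close>

lemma solvable_sym_group_4: "solvable (sym_group 4)"
proof -
  interpret S: group "sym_group 4" by (rule sym_group_is_group)
  have "solvable_seq (sym_group 4) {id}"
    using solvable_seq.unity[of "sym_group 4"] by (simp add: sym_group_one)
  moreover have "perms_of_words [[1,2,3,4]] \<subseteq> {id}"
  proof
    fix p assume "p \<in> perms_of_words [[1,2,3,4]]"
    then have "p permutes {1..4}" "p 1 = 1" "p 2 = 2" "p 3 = 3" "p 4 = 4"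
      by (auto simp: perms_of_words_def word_def)
    moreover have "{1..4::nat} = {1,2,3,4}" by auto
    ultimately have "p x = x" for x
      using permutes_not_in[of p "{1..4}" x] by (cases "x \<in> {1..4}") (simp, blast, metis)
    then show "p \<in> {id}" by auto
  qed
  moreover have "closed_words words_V4" "comm_words_in words_V4 [[1,2,3,4]]" by code_simp+
  ultimately have "solvable_seq (sym_group 4) (perms_of_words words_V4)"
    using S.solvable_seq_of_commutators[OF subgroup_perms_of_words] commutator_perms_of_words
    by blast
  moreover have "closed_words words_A4" "comm_words_in words_A4 words_V4" by code_simp+
  ultimately have "solvable_seq (sym_group 4) (perms_of_words words_A4)"
    using S.solvable_seq_of_commutators[OF subgroup_perms_of_words] commutator_perms_of_words
    by blast
  moreover have "comm_words_in words_S4 words_A4" by code_simp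
  moreover have carrier: "perms_of_words words_S4 = carrier (sym_group 4)"
    using words_complete by (auto simp: perms_of_words_def sym_group_carrier)
  ultimately have "solvable_seq (sym_group 4) (carrier (sym_group 4))"
    using S.solvable_seq_of_commutators[OF S.subgroup_self] commutator_perms_of_words
    by (metis (no_types, lifting))
  then show ?thesis by (simp add: solvable_def)
qed

section \<open>Triangular groups of permutations\<close>

text \<open>Addition, and at the same time subtraction, of functions to the field with two elements;
  \<open>meet_fun\<close> is their product.\<close>

definition xor_fun :: "('x \<Rightarrow> bool) \<Rightarrow> ('x \<Rightarrow> bool) \<Rightarrow> 'x \<Rightarrow> bool" (infixl \<open>\<triangle>\<close> 65)
  where "v \<triangle> w = (\<lambda>x. v x \<noteq> w x)"

definition meet_fun :: "('x \<Rightarrow> bool) \<Rightarrow> ('x \<Rightarrow> bool) \<Rightarrow> 'x \<Rightarrow> bool" (infixl \<open>\<sqinter>\<^sub>f\<close> 70)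
  where "v \<sqinter>\<^sub>f w = (\<lambda>x. v x \<and> w x)"

text \<open>All that the two upper bounds need to know about the permutations. Digit values start at
  \<open>1\<close> because \<open>sym_group d\<close> acts on \<open>{1..d}\<close>.\<close>

locale digit_group = group G for G :: "('x \<Rightarrow> 'x) monoid" (structure) +
  fixes S :: "'x set" and t :: "nat \<Rightarrow> 'x \<Rightarrow> nat" and N d :: nat
  assumes carrier_Bij: "carrier G \<subseteq> Bij S"
    and mult_apply: "\<lbrakk>g \<in> carrier G; h \<in> carrier G; x \<in> S\<rbrakk> \<Longrightarrow> (g \<otimes> h) x = g (h x)"
    and one_apply: "x \<in> S \<Longrightarrow> \<one> x = x"
    and digit_range: "\<lbrakk>k < N; x \<in> S\<rbrakk> \<Longrightarrow> t k x \<in> {1..d}"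
    and digits_separate: "\<lbrakk>x \<in> S; y \<in> S; \<And>k. k < N \<Longrightarrow> t k x = t k y\<rbrakk> \<Longrightarrow> x = y"
    and digits_triangular: "\<lbrakk>g \<in> carrier G; x \<in> S; y \<in> S; k < N; \<And>j. j \<le> k \<Longrightarrow> t j x = t j y\<rbrakk>
      \<Longrightarrow> t k (g x) = t k (g y)"
begin

section \<open>Points with equal leading digits, and the chain of stabilizers\<close>

abbreviation agree :: "nat \<Rightarrow> 'x \<Rightarrow> 'x \<Rightarrow> bool"
  where "agree k x y \<equiv> \<forall>j<k. t j x = t j y"

lemma closed_apply: "\<lbrakk>g \<in> carrier G; x \<in> S\<rbrakk> \<Longrightarrow> g x \<in> S"
  using carrier_Bij Bij_imp_funcset by blast

lemma inv_apply: "\<lbrakk>g \<in> carrier G; x \<in> S\<rbrakk> \<Longrightarrow> (inv g) (g x) = x" 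
  by (metis inv_closed l_inv mult_apply one_apply)

lemma apply_inv: "\<lbrakk>g \<in> carrier G; x \<in> S\<rbrakk> \<Longrightarrow> g ((inv g) x) = x" 
  by (metis inv_closed r_inv mult_apply one_apply)

lemma eq_oneI:
  assumes "g \<in> carrier G" "\<And>x. x \<in> S \<Longrightarrow> g x = x" shows "g = \<one>"
proof (rule extensionalityI)
  show "g \<in> extensional S" "\<one> \<in> extensional S"
    using assms(1) carrier_Bij Bij_imp_extensional one_closed by blast+
qed (use assms one_apply in auto)

lemma agree_apply:
  assumes "g \<in> carrier G" "x \<in> S" "y \<in> S" "k \<le> N" "agree k x y" shows "agree k (g x) (g y)"
  using digits_triangular[OF assms(1-3)] assms(4,5) by auto

text \<open>The inverse of \<open>g\<close> belongs to the group, so it is triangular too.\<close>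

lemma agree_apply_iff:
  assumes "g \<in> carrier G" "x \<in> S" "y \<in> S" "k \<le> N" shows "agree k (g x) (g y) \<longleftrightarrow> agree k x y"
  using agree_apply[OF assms] agree_apply[OF inv_closed[OF assms(1)], of "g x" "g y" k]
    inv_apply[OF assms(1)] closed_apply[OF assms(1)] assms by auto

text \<open>Elements of \<open>stab k\<close> keep every block of points with the same first
  \<open>k\<close> digits, hence act on the digit \<open>k\<close> inside each block. The chain
  leads from the whole group (\<open>stab_0\<close>) to the trivial one
  (\<open>stab_N\<close>).\<close>

definition stab :: "nat \<Rightarrow> ('x \<Rightarrow> 'x) set"
  where "stab k = {g \<in> carrier G. \<forall>x\<in>S. agree k (g x) x}"

lemma stab_0: "stab 0 = carrier G"
  by (auto simp: stab_def)

lemma stab_N: "stab N = {\<one>}"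
proof
  show "stab N \<subseteq> {\<one>}"
  proof
    fix g assume g: "g \<in> stab N"
    then have "g x = x" if "x \<in> S" for x
      using digits_separate[of "g x" x] closed_apply that by (auto simp: stab_def)
    then show "g \<in> {\<one>}" using eq_oneI g by (auto simp: stab_def)
  qed
qed (auto simp: stab_def one_apply)

lemma subgroup_stab:
  assumes "k \<le> N" shows "subgroup (stab k) G"
proof (rule subgroupI)
  show "stab k \<subseteq> carrier G" by (auto simp: stab_def)
  have "\<one> \<in> stab k" by (simp add: stab_def one_apply)
  then show "stab k \<noteq> {}" by blast
next
  fix g assume g: "g \<in> stab k"
  have "agree k ((inv g) x) x" if x: "x \<in> S" for x
  proof -
    have "agree k (g ((inv g) x)) ((inv g) x)" using g x closed_apply by (auto simp: stab_def)
    then show ?thesis using apply_inv[of g x] g x by (auto simp: stab_def)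
  qed
  then show "inv g \<in> stab k" using g by (auto simp: stab_def)
next
  fix g h assume g: "g \<in> stab k" and h: "h \<in> stab k"
  have "agree k ((g \<otimes> h) x) x" if x: "x \<in> S" for x
    using g h x closed_apply[of h x] mult_apply[of g h x] by (simp add: stab_def)
  then show "g \<otimes> h \<in> stab k" using g h by (auto simp: stab_def)
qed

text \<open>The choice of the point with digit \<open>v\<close> is immaterial by triangularity.\<close>

definition block_perm :: "nat \<Rightarrow> 'x \<Rightarrow> ('x \<Rightarrow> 'x) \<Rightarrow> nat \<Rightarrow> nat"
  where "block_perm k x g v =
    (if \<exists>y\<in>S. agree k y x \<and> t k y = v
     then t k (g (SOME y. y \<in> S \<and> agree k y x \<and> t k y = v)) else v)"

lemma block_perm_digit:
  assumes "g \<in> carrier G" "k < N" "x \<in> S" "y \<in> S" "agree k y x"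
  shows "block_perm k x g (t k y) = t k (g y)"
proof -
  let ?P = "\<lambda>z. z \<in> S \<and> agree k z x \<and> t k z = t k y"
  define z where "z = (SOME z. ?P z)"
  have z: "?P z" unfolding z_def by (rule someI[of ?P y]) (use assms in auto)
  have "t j z = t j y" if "j \<le> k" for j 
    using z assms(5) that by (cases "j = k") auto
  then have "t k (g z) = t k (g y)"
    using digits_triangular[of g z y k] z assms by auto
  moreover have "block_perm k x g (t k y) = t k (g z)"
    using assms unfolding block_perm_def z_def by auto
  ultimately show ?thesis by simp
qed

lemma block_perm_other:
  assumes "\<not> (\<exists>y\<in>S. agree k y x \<and> t k y = v)" shows "block_perm k x g v = v"
  unfolding block_perm_def using assms by auto

lemma block_perm_mult:
  assumes "g \<in> stab k" "h \<in> stab k" "k < N" "x \<in> S"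
  shows "block_perm k x (g \<otimes> h) v = block_perm k x g (block_perm k x h v)"
proof (cases "\<exists>y\<in>S. agree k y x \<and> t k y = v")
  case True
  then obtain y where y: "y \<in> S" "agree k y x" "v = t k y" by auto
  have "h y \<in> S" "agree k (h y) x" using assms y closed_apply by (auto simp: stab_def)
  then show ?thesis 
    using block_perm_digit[of "g \<otimes> h" k x y] block_perm_digit[of g k x "h y"]
      block_perm_digit[of h k x y] assms y mult_apply by (auto simp: stab_def)
qed (simp add: block_perm_other)

lemma block_perm_one:
  assumes "k < N" "x \<in> S" shows "block_perm k x \<one> = id"
proof
  show "block_perm k x \<one> v = id v" for v
    by (cases "\<exists>y\<in>S. agree k y x \<and> t k y = v")
      (use block_perm_digit[of \<one> k x] assms one_apply in \<open>auto simp: block_perm_other\<close>)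
qed

text \<open>The block map of \<open>inv g\<close> is a two-sided inverse. Values that do not occur
  in the block are fixed by the default in \<open>block_perm\<close>, so that small blocks also give
  permutations of all of \<open>{1..d}\<close>.\<close>

lemma block_perm_permutes:
  assumes g: "g \<in> stab k" and k: "k < N" and x: "x \<in> S"
  shows "block_perm k x g permutes {1..d}"
proof -
  have h: "inv g \<in> stab k" using subgroup.m_inv_closed[OF subgroup_stab] g k by simp
  have [simp]: "g \<in> carrier G" using g by (auto simp: stab_def)
  have "block_perm k x g \<circ> block_perm k x (inv g) = id" "block_perm k x (inv g) \<circ> block_perm k x g = id"
    using block_perm_mult[OF g h k x] block_perm_mult[OF h g k x] block_perm_one[OF k x]
    by (simp_all add: fun_eq_iff)
  then have "bij (block_perm k x g)" using o_bij by blast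
  moreover have "block_perm k x g v = v" if "v \<notin> {1..d}" for v
    using block_perm_other[of k x v g] digit_range[OF k] that by blast
  ultimately show ?thesis unfolding permutes_def by (auto simp: bij_iff)
qed

lemma block_perm_trivial:
  assumes "g \<in> stab k" "k < N" and trivial: "\<And>x. x \<in> S \<Longrightarrow> block_perm k x g = id"
  shows "g \<in> stab (Suc k)"
proof -
  have "t k (g x) = t k x" if "x \<in> S" for x
    using block_perm_digit[of g k x x] trivial[OF that] assms that by (auto simp: stab_def)
  then show ?thesis using assms(1) by (auto simp: stab_def less_Suc_eq)
qed

text \<open>For each \<open>x\<close> the block action is a homomorphism from \<open>stab k\<close>
  to \<open>sym_group d'\<close>, and it carries the \<open>n\<close>-th derived subgroup into that
  of \<open>sym_group d'\<close>, which is trivial. An element that acts trivially on all blocks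
  fixes the digit \<open>k\<close> as well. Allowing \<open>d'\<close> above \<open>d\<close> lets
  one symmetric group serve all smaller ones.\<close>

lemma derived_stab:
  assumes "d \<le> d'" "(derived (sym_group d') ^^ n) (carrier (sym_group d')) = {id}" "k < N"
  shows "(derived G ^^ n) (stab k) \<subseteq> stab (Suc k)"
proof
  fix g assume g: "g \<in> (derived G ^^ n) (stab k)"
  have sub: "subgroup (stab k) G" using subgroup_stab assms(3) by simp
  let ?H = "G\<lparr>carrier := stab k\<rparr>"
  have H: "group ?H" using subgroup_imp_group[OF sub] .
  interpret H: group ?H by (rule H)
  \<comment> \<open>The homomorphism lives on the subgroup \<open>stab k\<close>, so the derived
    series formed there is identified with the one formed in \<open>G\<close>.\<close>
  have der: "(derived ?H ^^ m) (stab k) = (derived G ^^ m) (stab k) \<and> (derived G ^^ m) (stab k) \<subseteq> stab k" for m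
  proof (induction m)
    case (Suc m)
    then show ?case using derived_consistent[OF _ sub] derived_incl[OF _ sub] by simp
  qed simp
  have gk: "g \<in> stab k" using der g by blast
  show "g \<in> stab (Suc k)"
  proof (rule block_perm_trivial[OF gk assms(3)])
    fix x assume x: "x \<in> S"
    interpret h: group_hom ?H "sym_group d'" "block_perm k x"
    proof (intro group_hom.intro group_hom_axioms.intro H sym_group_is_group homI)
      fix f assume "f \<in> carrier ?H"
      then have "block_perm k x f permutes {1..d}" using block_perm_permutes assms x by simp
      then show "block_perm k x f \<in> carrier (sym_group d')"
        using permutes_subset assms(1) by (fastforce simp: sym_group_carrier)
    qed (use block_perm_mult[OF _ _ assms(3) x] in \<open>auto simp: sym_group_mult\<close>)
    have "block_perm k x g \<in> block_perm k x ` (derived ?H ^^ n) (stab k)" using g der by blast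
    also have "\<dots> = (derived (sym_group d') ^^ n) (block_perm k x ` stab k)"
      by (subst h.exp_of_derived_img) auto
    also have "\<dots> \<subseteq> (derived (sym_group d') ^^ n) (carrier (sym_group d'))"
      by (rule group.mono_exp_of_derived[OF sym_group_is_group]) (use h.hom_closed in auto)
    finally show "block_perm k x g = id" using assms(2) by simp
  qed
qed

text \<open>Each digit costs \<open>n\<close> further derivations, where \<open>n\<close>
  derivations exhaust the symmetric group on four letters.\<close>

theorem solvable_digit_group:
  assumes "d \<le> 4" shows "solvable G"
proof -
  obtain n where n: "(derived (sym_group 4) ^^ n) (carrier (sym_group 4)) = {id}"
    using solvable_sym_group_4 group.solvable_iff_trivial_derived_seq[OF sym_group_is_group]
    by (auto simp: sym_group_one)
  have "(derived G ^^ (n * k)) (carrier G) \<subseteq> stab k" if "k \<le> N" for k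
    using that
  proof (induction k)
    case 0
    then show ?case by (simp add: stab_0)
  next
    case (Suc k)
    have "(derived G ^^ (n * Suc k)) (carrier G) = (derived G ^^ n) ((derived G ^^ (n * k)) (carrier G))"
      by (simp add: funpow_add)
    also have "\<dots> \<subseteq> (derived G ^^ n) (stab k)"
      using Suc by (intro mono_exp_of_derived) auto
    also have "\<dots> \<subseteq> stab (Suc k)"
      using derived_stab[OF assms n] Suc.prems by simp
    finally show ?case .
  qed
  from this[of N] have "(derived G ^^ (n * N)) (carrier G) \<subseteq> {\<one>}" by (simp add: stab_N)
  moreover have "\<one> \<in> (derived G ^^ (n * N)) (carrier G)"
    using exp_of_derived_is_subgroup[OF subgroup_self] subgroup.one_closed by blast
  ultimately have "(derived G ^^ (n * N)) (carrier G) = {\<one>}" by blast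
  then show ?thesis using solvable_iff_trivial_derived_seq by blast
qed

section \<open>Unipotent action on functions and nilpotency\<close>

text \<open>Functions to the field with two elements are represented by predicates.\<close>

primrec unipotent_level :: "nat \<Rightarrow> ('x \<Rightarrow> bool) set"
  where
    "unipotent_level 0 = {v. \<forall>x\<in>S. \<not> v x}"
  | "unipotent_level (Suc i) = {v. \<forall>g\<in>carrier G. (v \<circ> g) \<triangle> v \<in> unipotent_level i}"

text \<open>Level \<open>i\<close> consists of the functions that every product of \<open>i\<close>
  operators \<open>g - 1\<close> annihilates on \<open>S\<close>. Since the group preserves
  \<open>S\<close>, values outside \<open>S\<close> never matter.\<close>

lemma level_cong:
  "\<lbrakk>v \<in> unipotent_level i; \<And>x. x \<in> S \<Longrightarrow> v x = w x\<rbrakk> \<Longrightarrow> w \<in> unipotent_level i"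
proof (induction i arbitrary: v w)
  case (Suc i)
  have "(w \<circ> g) \<triangle> w \<in> unipotent_level i" if "g \<in> carrier G" for g
  proof (rule Suc.IH)
    show "(v \<circ> g) \<triangle> v \<in> unipotent_level i" using Suc.prems(1) that by simp
    show "((v \<circ> g) \<triangle> v) x = ((w \<circ> g) \<triangle> w) x" if "x \<in> S" for x
      using Suc.prems(2) closed_apply \<open>g \<in> carrier G\<close> that by (simp add: xor_fun_def)
  qed
  then show ?case by simp
qed simp

lemma level_add:
  "\<lbrakk>v \<in> unipotent_level i; w \<in> unipotent_level i\<rbrakk> \<Longrightarrow> v \<triangle> w \<in> unipotent_level i"
proof (induction i arbitrary: v w)
  case 0
  then show ?case by (simp add: xor_fun_def)
next
  case (Suc i)
  have "((v \<triangle> w) \<circ> g) \<triangle> (v \<triangle> w) \<in> unipotent_level i" if g: "g \<in> carrier G" for g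
  proof (rule level_cong)
    show "((v \<circ> g) \<triangle> v) \<triangle> ((w \<circ> g) \<triangle> w) \<in> unipotent_level i"
      using Suc.IH Suc.prems g by simp
  qed (simp only: xor_fun_def comp_def, argo)
  then show ?case by simp
qed

lemma level_translate_0: "\<lbrakk>v \<in> unipotent_level 0; g \<in> carrier G\<rbrakk> \<Longrightarrow> (v \<circ> g) \<triangle> v \<in> unipotent_level 0"
  by (simp add: closed_apply xor_fun_def)

lemma level_Suc: "v \<in> unipotent_level i \<Longrightarrow> v \<in> unipotent_level (Suc i)"
proof (induction i arbitrary: v)
  case 0
  then show ?case using level_translate_0 by (simp del: unipotent_level.simps(1))
next
  case (Suc i)
  then have "(v \<circ> g) \<triangle> v \<in> unipotent_level (Suc i)" if "g \<in> carrier G" for g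
    using that by simp
  then show ?case unfolding unipotent_level.simps(2)[of "Suc i"] by blast
qed

lemma level_mono: "\<lbrakk>v \<in> unipotent_level i; i \<le> j\<rbrakk> \<Longrightarrow> v \<in> unipotent_level j"
  by (induction j) (auto simp: le_Suc_eq level_Suc simp del: unipotent_level.simps)

text \<open>\<open>v g = (v g - v) + v\<close>, and both summands lie in level \<open>i\<close>
  because the levels increase.\<close>

lemma level_translate:
  assumes "v \<in> unipotent_level i" "g \<in> carrier G" shows "v \<circ> g \<in> unipotent_level i"
proof -
  have "(v \<circ> g) \<triangle> v \<in> unipotent_level i"
    using level_Suc[OF assms(1)] assms(2) by simp
  from level_add[OF this assms(1)] show ?thesis by (rule level_cong) (simp only: xor_fun_def comp_def, argo)
qed

lemma all_less_Suc_iff: "(\<forall>j<Suc k. P j) \<longleftrightarrow> (\<forall>j<k. P j) \<and> P k"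
  by (auto simp: less_Suc_eq)

definition block_functions :: "nat \<Rightarrow> ('x \<Rightarrow> bool) set"
  where "block_functions k = {v. \<forall>x\<in>S. \<forall>y\<in>S. agree k x y \<longrightarrow> v x = v y}"

definition binary_digit :: "nat \<Rightarrow> 'x \<Rightarrow> bool"
  where "binary_digit k x \<longleftrightarrow> t k x = 1"

lemma binary_digit_eq_iff:
  assumes "d = 2" "k < N" "x \<in> S" "y \<in> S"
  shows "binary_digit k x = binary_digit k y \<longleftrightarrow> t k x = t k y"
proof -
  have "t k x \<in> {1,2}" "t k y \<in> {1,2}" using digit_range[OF assms(2)] assms by fastforce+
  then show ?thesis by (auto simp: binary_digit_def)
qed

text \<open>Among points with equal earlier digits, \<open>g\<close> preserves both equality and
  inequality of the digit \<open>k\<close>. With only two values this says that \<open>g\<close>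
  adds a constant to that digit throughout a block.\<close>

lemma binary_digit_shift:
  assumes "d = 2" "k < N" "g \<in> carrier G"
  shows "(binary_digit k \<circ> g) \<triangle> binary_digit k \<in> block_functions k"
  unfolding block_functions_def
proof (intro CollectI ballI impI)
  fix x y assume x: "x \<in> S" and y: "y \<in> S" and a: "agree k x y"
  have "agree (Suc k) (g x) (g y) \<longleftrightarrow> agree (Suc k) x y"
    using agree_apply_iff[OF assms(3) x y] assms by simp
  moreover have "agree k (g x) (g y)" using agree_apply[OF assms(3) x y _ a] assms by simp
  ultimately have "t k (g x) = t k (g y) \<longleftrightarrow> t k x = t k y"
    using a unfolding all_less_Suc_iff by blast
  then have "binary_digit k (g x) = binary_digit k (g y) \<longleftrightarrow> binary_digit k x = binary_digit k y"
    using binary_digit_eq_iff[OF assms(1,2)] closed_apply[OF assms(3)] x y by simp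
  then show "((binary_digit k \<circ> g) \<triangle> binary_digit k) x = ((binary_digit k \<circ> g) \<triangle> binary_digit k) y"
    by (simp only: xor_fun_def comp_def) argo
qed

lemma block_functions_translate:
  assumes "v \<in> block_functions k" "g \<in> carrier G" "k \<le> N"
  shows "v \<circ> g \<in> block_functions k"
  unfolding block_functions_def
proof (intro CollectI ballI impI)
  fix x y assume "x \<in> S" "y \<in> S" "agree k x y"
  then have "g x \<in> S" "g y \<in> S" "agree k (g x) (g y)"
    using closed_apply[OF assms(2)] agree_apply[OF assms(2) _ _ assms(3)] by blast+
  then show "(v \<circ> g) x = (v \<circ> g) y" using assms(1) unfolding block_functions_def comp_def by blast
qed

lemma block_functions_add:
  "\<lbrakk>v \<in> block_functions k; w \<in> block_functions k\<rbrakk> \<Longrightarrow> v \<triangle> w \<in> block_functions k"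
  unfolding block_functions_def xor_fun_def by blast

lemma block_functions_meet:
  "\<lbrakk>v \<in> block_functions k; w \<in> block_functions k\<rbrakk> \<Longrightarrow> v \<sqinter>\<^sub>f w \<in> block_functions k"
  unfolding block_functions_def meet_fun_def by blast

text \<open>The identity used is \<open>(t v) g - t v = t (v g - v) + (t g - t) (v g)\<close>, where \<open>t g - t\<close> is a
  function of the digits before \<open>k\<close>.\<close>

lemma digit_times_level:
  assumes d: "d = 2" and k: "k < N" and m: "block_functions k \<subseteq> unipotent_level m"
    and v: "v \<in> block_functions k" "v \<in> unipotent_level i"
  shows "binary_digit k \<sqinter>\<^sub>f v \<in> unipotent_level (m + i)"
  using v
proof (induction i arbitrary: v)
  case 0
  then have "binary_digit k \<sqinter>\<^sub>f v \<in> unipotent_level 0" by (simp add: meet_fun_def)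
  then show ?case by (rule level_mono) simp
next
  case (Suc i)
  let ?t = "binary_digit k"
  have "((?t \<sqinter>\<^sub>f v) \<circ> g) \<triangle> (?t \<sqinter>\<^sub>f v) \<in> unipotent_level (m + i)"
    if g: "g \<in> carrier G" for g
  proof -
    let ?s = "(?t \<circ> g) \<triangle> ?t"
    have tr: "v \<circ> g \<in> block_functions k"
      using block_functions_translate Suc.prems(1) g k by simp
    then have "?t \<sqinter>\<^sub>f ((v \<circ> g) \<triangle> v) \<in> unipotent_level (m + i)"
      using Suc.prems g block_functions_add by (intro Suc.IH) simp_all
    moreover have "?s \<sqinter>\<^sub>f (v \<circ> g) \<in> unipotent_level m"
      using block_functions_meet[OF binary_digit_shift[OF d k g] tr] m by blast
    then have "?s \<sqinter>\<^sub>f (v \<circ> g) \<in> unipotent_level (m + i)" by (rule level_mono) simp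
    ultimately have "(?t \<sqinter>\<^sub>f ((v \<circ> g) \<triangle> v)) \<triangle> (?s \<sqinter>\<^sub>f (v \<circ> g)) \<in> unipotent_level (m + i)"
      by (rule level_add)
    then show ?thesis
      by (rule level_cong) (simp only: xor_fun_def meet_fun_def comp_def, argo)
  qed
  then show ?case by simp
qed

text \<open>Over the field with two elements a function of \<open>k + 1\<close> digits has the form
  \<open>p0 + t (p0 + p1)\<close>, where \<open>t\<close> is the last digit and \<open>p0\<close>,
  \<open>p1\<close> are functions of the first \<open>k\<close> digits that give its values for the
  two values of \<open>t\<close>. By \<open>digit_times_level\<close> the level at most
  doubles.\<close>

lemma block_functions_Suc:
  assumes d: "d = 2" and k: "k < N" and m: "block_functions k \<subseteq> unipotent_level m"
  shows "block_functions (Suc k) \<subseteq> unipotent_level (m + m)"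
proof
  fix w assume w: "w \<in> block_functions (Suc k)"
  define P where "P b x y \<longleftrightarrow> y \<in> S \<and> agree k y x \<and> binary_digit k y = b" for b x y
  \<comment> \<open>\<open>p b x\<close> is the value of \<open>w\<close> at some point of the block
    of \<open>x\<close> with digit \<open>b\<close>. Where there is no such point the value is
    \<open>False\<close>, which is never compared with \<open>w\<close>.\<close>
  define p where "p b x \<longleftrightarrow> (\<exists>y. P b x y) \<and> w (SOME y. P b x y)" for b x
  have p_block: "p b \<in> block_functions k" for b
  proof -
    have "p b x = p b y" if "agree k x y" for x y
    proof -
      \<comment> \<open>The predicate depends on the block only, so \<open>SOME\<close> picks the
        same point for \<open>x\<close> and \<open>y\<close>.\<close>
      have "P b x = P b y" unfolding P_def by (intro ext) (metis that)
      then show ?thesis by (simp add: p_def)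
    qed
    then show ?thesis unfolding block_functions_def by blast
  qed
  have p_digit: "p (binary_digit k x) x = w x" if "x \<in> S" for x
  proof -
    have ex: "P (binary_digit k x) x x" using that by (simp add: P_def)
    define y where "y = (SOME y. P (binary_digit k x) x y)"
    have "P (binary_digit k x) x y" unfolding y_def using ex by (rule someI)
    then have "y \<in> S" "agree (Suc k) y x"
      using binary_digit_eq_iff[OF d k _ that, of y] unfolding P_def all_less_Suc_iff by blast+
    then have "w y = w x" using w that unfolding block_functions_def by blast
    then show ?thesis using ex unfolding p_def y_def by auto
  qed
  let ?v = "p False \<triangle> p True"
  have "?v \<in> block_functions k" using block_functions_add p_block by blast
  then have "binary_digit k \<sqinter>\<^sub>f ?v \<in> unipotent_level (m + m)"
    using digit_times_level[OF d k m] m by blast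
  moreover have "p False \<in> unipotent_level (m + m)"
    using p_block[of False] m level_mono[of "p False" m "m + m"] by auto
  ultimately have "p False \<triangle> (binary_digit k \<sqinter>\<^sub>f ?v) \<in> unipotent_level (m + m)"
    using level_add by blast
  moreover have "(p False \<triangle> (binary_digit k \<sqinter>\<^sub>f ?v)) x = w x" if "x \<in> S" for x
  proof -
    have "(binary_digit k x \<longrightarrow> p True x = w x) \<and> (\<not> binary_digit k x \<longrightarrow> p False x = w x)"
      using p_digit[OF that] by (cases "binary_digit k x") simp_all
    then show ?thesis by (simp only: xor_fun_def meet_fun_def) argo
  qed
  ultimately show "w \<in> unipotent_level (m + m)" by (rule level_cong)
qed

text \<open>A function of no digits is constant on \<open>S\<close>, hence of level
  \<open>1\<close>. After all \<open>N\<close> digits the blocks are single points, so every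
  function is covered; the doubling gives the level \<open>2 ^ N\<close>.\<close>

lemma all_functions_unipotent:
  assumes "d = 2" obtains m where "\<And>v. v \<in> unipotent_level m"
proof -
  have "\<exists>m. block_functions k \<subseteq> unipotent_level m" if "k \<le> N" for k
    using that
  proof (induction k)
    case 0
    have "block_functions 0 \<subseteq> unipotent_level 1"
    proof
      fix v assume v: "v \<in> block_functions 0"
      then have "\<not> ((v \<circ> g) \<triangle> v) x" if "x \<in> S" "g \<in> carrier G" for x g
        using v that closed_apply[OF that(2,1)] unfolding block_functions_def xor_fun_def comp_def
        by blast
      then show "v \<in> unipotent_level 1" by simp
    qed
    then show ?case by blast
  next
    case (Suc k)
    then obtain m where "block_functions k \<subseteq> unipotent_level m" by auto
    then show ?case using block_functions_Suc[OF assms] Suc.prems by (meson Suc_le_lessD)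
  qed
  then obtain m where "block_functions N \<subseteq> unipotent_level m" by blast
  moreover have "v \<in> block_functions N" for v
    using digits_separate unfolding block_functions_def by blast
  ultimately show ?thesis using that by blast
qed

text \<open>The elements for which \<open>g - 1\<close> lowers levels by at least \<open>k\<close>.
  Every element lowers them by one (\<open>unipotent_1\<close>), and each commutator with the group
  gains one more step.\<close>

definition unipotent :: "nat \<Rightarrow> ('x \<Rightarrow> 'x) set"
  where "unipotent k = {g \<in> carrier G. \<forall>i. \<forall>v\<in>unipotent_level (i + k).
    (v \<circ> g) \<triangle> v \<in> unipotent_level i}"

lemma unipotentI:
  "\<lbrakk>g \<in> carrier G; \<And>i v. v \<in> unipotent_level (i + k) \<Longrightarrow> (v \<circ> g) \<triangle> v \<in> unipotent_level i\<rbrakk>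
    \<Longrightarrow> g \<in> unipotent k"
  unfolding unipotent_def by blast

lemma unipotentD:
  assumes "g \<in> unipotent k"
  shows "g \<in> carrier G" and "v \<in> unipotent_level (i + k) \<Longrightarrow> (v \<circ> g) \<triangle> v \<in> unipotent_level i"
  using assms unfolding unipotent_def by blast+

text \<open>Translating \<open>v g - v\<close> by the inverse of \<open>g\<close> gives
  \<open>v - v (inv g)\<close>, where the sign is immaterial; for products,
  \<open>v g h - v = (v g - v) h + (v h - v)\<close>. Both use that translations preserve
  levels.\<close>

lemma subgroup_unipotent: "subgroup (unipotent k) G"
proof (rule subgroupI)
  show "unipotent k \<subseteq> carrier G" by (auto simp: unipotent_def)
  have "(v \<circ> \<one>) \<triangle> v \<in> unipotent_level i" for i v
    by (rule level_mono[of _ 0]) (simp_all add: one_apply xor_fun_def)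
  then have "\<one> \<in> unipotent k" by (intro unipotentI) simp_all
  then show "unipotent k \<noteq> {}" by blast
next
  fix g assume g: "g \<in> unipotent k"
  note gc = unipotentD(1)[OF g]
  show "inv g \<in> unipotent k"
  proof (rule unipotentI)
    fix i v assume "v \<in> unipotent_level (i + k)"
    then have "(v \<circ> g) \<triangle> v \<in> unipotent_level i" by (rule unipotentD(2)[OF g])
    from level_translate[OF this inv_closed[OF gc]]
    show "(v \<circ> inv g) \<triangle> v \<in> unipotent_level i"
      by (rule level_cong) (simp only: apply_inv gc xor_fun_def comp_def, argo)
  qed (use gc in simp)
next
  fix g h assume g: "g \<in> unipotent k" and h: "h \<in> unipotent k"
  note gc = unipotentD(1)[OF g] and hc = unipotentD(1)[OF h]
  show "g \<otimes> h \<in> unipotent k"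
  proof (rule unipotentI)
    fix i v assume "v \<in> unipotent_level (i + k)"
    then have "(v \<circ> g) \<triangle> v \<in> unipotent_level i" "(v \<circ> h) \<triangle> v \<in> unipotent_level i"
      using unipotentD(2) g h by blast+
    from level_add[OF level_translate[OF this(1) hc] this(2)]
    show "(v \<circ> (g \<otimes> h)) \<triangle> v \<in> unipotent_level i"
      by (rule level_cong) (simp only: mult_apply gc hc xor_fun_def comp_def, argo)
  qed (use gc hc in simp)
qed

lemma unipotent_1: "unipotent 1 = carrier G"
  by (auto simp: unipotent_def)

text \<open>For \<open>c = [h,g]\<close>, translating \<open>v c - v\<close> by \<open>g h\<close> gives \<open>v h g - v g h\<close>, which is the ring
  commutator of \<open>h - 1\<close> and \<open>g - 1\<close> applied to \<open>v\<close>.\<close>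

lemma commutator_unipotent:
  assumes h: "h \<in> unipotent k" and g: "g \<in> carrier G"
  shows "h \<otimes> g \<otimes> inv h \<otimes> inv g \<in> unipotent (Suc k)"
proof (rule unipotentI)
  define c where "c = h \<otimes> g \<otimes> inv h \<otimes> inv g"
  note hc = unipotentD(1)[OF h]
  have cc: "c \<in> carrier G" and gh: "g \<otimes> h \<in> carrier G" using hc g by (auto simp: c_def)
  then show "h \<otimes> g \<otimes> inv h \<otimes> inv g \<in> carrier G" by (simp add: c_def)
  have "c \<otimes> g \<otimes> h = h \<otimes> g"
    unfolding c_def using hc g by (simp add: inv_solve_right m_assoc)
  then have comm: "c \<otimes> (g \<otimes> h) = h \<otimes> g" using hc g cc by (simp add: m_assoc)
  fix i v assume v: "v \<in> unipotent_level (i + Suc k)"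
  let ?a = "(v \<circ> h) \<triangle> v" and ?b = "(v \<circ> g) \<triangle> v"
  have a: "?a \<in> unipotent_level (Suc i)"
    using unipotentD(2)[OF h, of v "Suc i"] v by (simp del: unipotent_level.simps)
  have b: "?b \<in> unipotent_level (i + k)" using v g by simp
  have "(?a \<circ> g) \<triangle> ?a \<in> unipotent_level i" using a g by simp
  from level_add[OF this unipotentD(2)[OF h b]]
  have "(v \<circ> c \<circ> (g \<otimes> h)) \<triangle> (v \<circ> (g \<otimes> h)) \<in> unipotent_level i"
  proof (rule level_cong)
    fix x assume x: "x \<in> S"
    have "c (g (h x)) = h (g x)" "(g \<otimes> h) x = g (h x)"
      using comm mult_apply[OF cc gh x] mult_apply[OF hc g x] mult_apply[OF g hc x] by simp_all
    then show "(((?a \<circ> g) \<triangle> ?a) \<triangle> ((?b \<circ> h) \<triangle> ?b)) x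
      = ((v \<circ> c \<circ> (g \<otimes> h)) \<triangle> (v \<circ> (g \<otimes> h))) x"
      by (simp only: xor_fun_def comp_def, argo)
  qed
  from level_translate[OF this inv_closed[OF gh]]
  show "(v \<circ> (h \<otimes> g \<otimes> inv h \<otimes> inv g)) \<triangle> v \<in> unipotent_level i"
    unfolding c_def[symmetric]
    by (rule level_cong) (simp only: apply_inv gh xor_fun_def comp_def)
qed

lemma lower_central_unipotent: "lower_central G k \<subseteq> unipotent (Suc k)"
proof (induction k)
  case 0
  then show ?case using unipotent_1 by simp
next
  case (Suc k)
  show ?case unfolding lower_central.simps
    by (rule generate_subgroup_incl[OF _ subgroup_unipotent]) (use Suc commutator_unipotent in blast)
qed

text \<open>Once all functions lie in level \<open>m\<close>, an element that lowers levels by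
  \<open>Suc m\<close> changes no function on \<open>S\<close>. Applied to the indicator
  \<open>(=) x\<close> of a point, this says that it fixes \<open>x\<close>.\<close>

theorem nilpotent_digit_group:
  assumes "d = 2" shows "nilpotent_group G"
proof -
  obtain m where m: "\<And>v. v \<in> unipotent_level m" using all_functions_unipotent[OF assms] by blast
  have "lower_central G m \<subseteq> {\<one>}"
  proof
    fix g assume "g \<in> lower_central G m"
    then have g: "g \<in> unipotent (Suc m)" using lower_central_unipotent by blast
    have "g x = x" if x: "x \<in> S" for x
    proof (rule ccontr)
      assume neq: "g x \<noteq> x"
      have "((=) x \<circ> g) \<triangle> (=) x \<in> unipotent_level 0"
        by (rule unipotentD(2)[OF g]) (use m level_Suc in \<open>simp del: unipotent_level.simps\<close>)
      then show False using x neq by (auto simp: xor_fun_def)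
    qed
    then show "g \<in> {\<one>}" using eq_oneI unipotentD(1)[OF g] by blast
  qed
  moreover have "\<one> \<in> lower_central G m"
    by (cases m) (auto intro: generate.one)
  ultimately have "lower_central G m = {\<one>}" by blast
  then show ?thesis using is_group unfolding nilpotent_group_def by blast
qed

end

section \<open>Polynomial functions\<close>

context cring begin

section \<open>Values of indexed polynomials\<close>

definition monom_value :: "('i \<Rightarrow> 'a) \<Rightarrow> 'i multiset \<Rightarrow> 'a"
  where "monom_value a m = (\<Otimes>i\<in>set_mset m. a i [^] count m i)"

lemma monom_value_closed:
  "a \<in> set_mset m \<rightarrow> carrier R \<Longrightarrow> monom_value a m \<in> carrier R"
  unfolding monom_value_def by (intro finprod_closed) auto

lemma monom_value_add_mset:
  assumes "a \<in> set_mset m \<rightarrow> carrier R" "a i \<in> carrier R"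
  shows "monom_value a (add_mset i m) = monom_value a m \<otimes> a i"
proof -
  have cl: "(\<lambda>j. a j [^] (k j :: nat)) \<in> set_mset m - {i} \<rightarrow> carrier R" for k
    using assms by auto
  \<comment> \<open>The power of \<open>a i\<close> is split off even when its exponent is zero, so
    that the remaining product is the same whether or not \<open>i\<close> occurs in
    \<open>m\<close>.\<close>
  have split: "monom_value a m = a i [^] count m i \<otimes> (\<Otimes>j\<in>set_mset m - {i}. a j [^] count m j)"
  proof (cases "i \<in># m")
    case True
    then have "set_mset m = insert i (set_mset m - {i})" by blast
    then have "monom_value a m = (\<Otimes>j\<in>insert i (set_mset m - {i}). a j [^] count m j)"
      unfolding monom_value_def by simp
    then show ?thesis using cl assms by (subst (asm) finprod_insert) auto
  next
    case False
    then have "count m i = 0" "set_mset m - {i} = set_mset m" by (auto simp: not_in_iff)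
    then show ?thesis unfolding monom_value_def using assms by (simp add: finprod_closed Pi_iff)
  qed
  have "set_mset (add_mset i m) = insert i (set_mset m - {i})" by auto
  then have "monom_value a (add_mset i m)
      = (\<Otimes>j\<in>insert i (set_mset m - {i}). a j [^] count (add_mset i m) j)"
    unfolding monom_value_def by simp
  also have "\<dots> = a i [^] Suc (count m i) \<otimes> (\<Otimes>j\<in>set_mset m - {i}. a j [^] count (add_mset i m) j)"
    using cl assms by (subst finprod_insert) auto
  also have "(\<Otimes>j\<in>set_mset m - {i}. a j [^] count (add_mset i m) j)
      = (\<Otimes>j\<in>set_mset m - {i}. a j [^] count m j)"
    using cl by (intro finprod_cong') auto
  finally show ?thesis
    unfolding split using assms cl by (simp add: finprod_closed m_ac)
qed

text \<open>Evaluation sums over the exact support, which cancellation can shrink. Summing over any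
  finite superset lets the values of different polynomials be compared term by term.\<close>

lemma value_superset:
  assumes "finite S" "{m. P m \<noteq> \<zero>} \<subseteq> S"
    and "\<And>m. m \<in> S \<Longrightarrow> P m \<in> carrier R \<and> monom_value a m \<in> carrier R"
  shows "mpoly_value R a P = (\<Oplus>m\<in>S. P m \<otimes> monom_value a m)"
  unfolding mpoly_eval_def monom_value_def[symmetric]
  using assms by (intro add.finprod_mono_neutral_cong_left) auto

lemma pset_coeff_closed: "P \<in> indexed_pset I (carrier R) \<Longrightarrow> P m \<in> carrier R"
  using indexed_pset_in_carrier[of "carrier R" P I] carrier_coeffE by blast

lemma pset_finite_support: "P \<in> indexed_pset I (carrier R) \<Longrightarrow> finite {m. P m \<noteq> \<zero>}"
proof (induction rule: indexed_pset.induct)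
  case (indexed_const k)
  show ?case by (rule finite_subset[of _ "{{#}}"]) (auto simp: indexed_const_def)
next
  case (indexed_padd P Q)
  have "{m. indexed_padd P Q m \<noteq> \<zero>} \<subseteq> {m. P m \<noteq> \<zero>} \<union> {m. Q m \<noteq> \<zero>}"
    by (auto simp: indexed_padd_def)
  then show ?case using indexed_padd finite_subset by blast
next
  case (indexed_pmult P i)
  have "{m. indexed_pmult P i m \<noteq> \<zero>} \<subseteq> add_mset i ` {m. P m \<noteq> \<zero>}"
  proof
    fix m assume "m \<in> {m. indexed_pmult P i m \<noteq> \<zero>}"
    then have "i \<in># m" "P (m - {#i#}) \<noteq> \<zero>"
      by (auto simp: indexed_pmult_def split: if_splits)
    then show "m \<in> add_mset i ` {m. P m \<noteq> \<zero>}"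
      by (intro image_eqI[of _ _ "m - {#i#}"]) auto
  qed
  then show ?case using indexed_pmult finite_subset by blast
qed

lemma pset_support: "P \<in> indexed_pset I (carrier R) \<Longrightarrow> P m \<noteq> \<zero> \<Longrightarrow> set_mset m \<subseteq> I"
proof (induction arbitrary: m rule: indexed_pset.induct)
  case (indexed_padd P Q)
  then show ?case
    using pset_coeff_closed[of Q I m] by (cases "P m = \<zero>") (auto simp: indexed_padd_def)
next
  case (indexed_pmult P i)
  then have "i \<in># m" "P (m - {#i#}) \<noteq> \<zero>"
    by (auto simp: indexed_pmult_def split: if_splits)
  then show ?case using indexed_pmult.IH[of "m - {#i#}"] indexed_pmult.hyps
    by (metis insert_DiffM insert_subset set_mset_add_mset_insert)
qed (auto simp: indexed_const_def split: if_splits)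

context
  fixes I :: "'i set" and a :: "'i \<Rightarrow> 'a"
  assumes a: "a \<in> I \<rightarrow> carrier R"
begin

lemma support_values_closed:
  assumes "P \<in> indexed_pset I (carrier R)" "P m \<noteq> \<zero>" shows "monom_value a m \<in> carrier R"
  using pset_support[OF assms] a by (intro monom_value_closed) blast

lemma value_closed: "P \<in> indexed_pset I (carrier R) \<Longrightarrow> mpoly_value R a P \<in> carrier R"
  unfolding mpoly_eval_def monom_value_def[symmetric]
  by (intro finsum_closed) (auto simp: pset_coeff_closed support_values_closed)

lemma value_const: "k \<in> carrier R \<Longrightarrow> mpoly_value R a (indexed_const k) = k"
  by (subst value_superset[of "{{#}}"]) (auto simp: indexed_const_def monom_value_def)

lemma value_padd:
  assumes "P \<in> indexed_pset I (carrier R)" "Q \<in> indexed_pset I (carrier R)"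
  shows "mpoly_value R a (indexed_padd P Q) = mpoly_value R a P \<oplus> mpoly_value R a Q"
proof -
  define S where "S = {m. P m \<noteq> \<zero>} \<union> {m. Q m \<noteq> \<zero>}"
  have fin: "finite S" using assms pset_finite_support unfolding S_def by blast
  have cl: "P m \<in> carrier R" "Q m \<in> carrier R" for m using assms pset_coeff_closed by blast+
  have mv: "monom_value a m \<in> carrier R" if "m \<in> S" for m
    using that assms support_values_closed unfolding S_def by blast
  have "{m. indexed_padd P Q m \<noteq> \<zero>} \<subseteq> S"
    unfolding S_def indexed_padd_def by auto
  then have "mpoly_value R a (indexed_padd P Q) = (\<Oplus>m\<in>S. indexed_padd P Q m \<otimes> monom_value a m)"
    using fin cl mv by (intro value_superset) (simp_all add: indexed_padd_def)
  also have "\<dots> = (\<Oplus>m\<in>S. P m \<otimes> monom_value a m \<oplus> Q m \<otimes> monom_value a m)"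
    using cl mv by (intro finsum_cong') (simp_all add: indexed_padd_def l_distr Pi_iff)
  also have "\<dots> = (\<Oplus>m\<in>S. P m \<otimes> monom_value a m) \<oplus> (\<Oplus>m\<in>S. Q m \<otimes> monom_value a m)"
    using cl mv by (intro finsum_addf) (simp_all add: Pi_iff)
  also have "(\<Oplus>m\<in>S. P m \<otimes> monom_value a m) = mpoly_value R a P"
    using fin cl mv by (intro value_superset[symmetric]) (auto simp: S_def)
  also have "(\<Oplus>m\<in>S. Q m \<otimes> monom_value a m) = mpoly_value R a Q"
    using fin cl mv by (intro value_superset[symmetric]) (auto simp: S_def)
  finally show ?thesis .
qed

lemma value_pmult:
  assumes P: "P \<in> indexed_pset I (carrier R)" and i: "i \<in> I"
  shows "mpoly_value R a (indexed_pmult P i) = mpoly_value R a P \<otimes> a i"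
proof -
  define S where "S = {m. P m \<noteq> \<zero>}"
  have ai: "a i \<in> carrier R" using a i by blast
  have fin: "finite S" using P pset_finite_support unfolding S_def by blast
  have cl: "P m \<in> carrier R" for m using P pset_coeff_closed by blast
  have am: "a \<in> set_mset m \<rightarrow> carrier R" if "m \<in> S" for m
    using pset_support[OF P] that a unfolding S_def by blast
  have mv: "monom_value a m \<in> carrier R" if "m \<in> S" for m
    using that P support_values_closed unfolding S_def by blast
  have mv': "monom_value a (add_mset i m) = monom_value a m \<otimes> a i" if "m \<in> S" for m
    by (rule monom_value_add_mset[OF am[OF that] ai])
  have pm: "indexed_pmult P i (add_mset i m) = P m" for m
    by (simp add: indexed_pmult_def)
  have sub: "{m. indexed_pmult P i m \<noteq> \<zero>} \<subseteq> add_mset i ` S"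
  proof
    fix m assume "m \<in> {m. indexed_pmult P i m \<noteq> \<zero>}"
    then have "i \<in># m" "P (m - {#i#}) \<noteq> \<zero>"
      by (auto simp: indexed_pmult_def split: if_splits)
    then show "m \<in> add_mset i ` S"
      by (intro image_eqI[of _ _ "m - {#i#}"]) (auto simp: S_def)
  qed
  have "mpoly_value R a (indexed_pmult P i)
      = (\<Oplus>m\<in>add_mset i ` S. indexed_pmult P i m \<otimes> monom_value a m)"
    by (rule value_superset[OF finite_imageI[OF fin] sub]) (auto simp: cl mv mv' ai pm)
  also have "\<dots> = (\<Oplus>m\<in>S. indexed_pmult P i (add_mset i m) \<otimes> monom_value a (add_mset i m))"
    by (intro add.finprod_reindex) (auto simp: inj_on_def cl mv mv' ai pm)
  also have "\<dots> = (\<Oplus>m\<in>S. (P m \<otimes> monom_value a m) \<otimes> a i)"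
    by (intro finsum_cong') (simp_all add: cl mv mv' ai pm m_assoc)
  also have "\<dots> = (\<Oplus>m\<in>S. P m \<otimes> monom_value a m) \<otimes> a i"
    by (intro finsum_ldistr[symmetric] fin ai) (simp add: cl mv Pi_iff)
  also have "(\<Oplus>m\<in>S. P m \<otimes> monom_value a m) = mpoly_value R a P"
    unfolding mpoly_eval_def monom_value_def S_def ..
  finally show ?thesis .
qed

end

lemma value_cong:
  assumes "P \<in> indexed_pset I (carrier R)" "a \<in> I \<rightarrow> carrier R" "\<And>i. i \<in> I \<Longrightarrow> a i = b i"
  shows "mpoly_value R a P = mpoly_value R b P"
proof -
  have b: "b \<in> I \<rightarrow> carrier R" using assms(2,3) by (metis Pi_iff)
  have "monom_value a m = monom_value b m" if "P m \<noteq> \<zero>" for m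
    using pset_support[OF assms(1) that] b assms(3) unfolding monom_value_def
    by (intro finprod_cong') (auto simp: subset_iff Pi_iff)
  moreover have "monom_value b m \<in> carrier R" if "P m \<noteq> \<zero>" for m
    using pset_support[OF assms(1) that] b by (intro monom_value_closed) blast
  ultimately show ?thesis
    unfolding mpoly_eval_def monom_value_def[symmetric]
    by (intro finsum_cong') (simp_all add: pset_coeff_closed[OF assms(1)])
qed

section \<open>Functions induced by polynomials\<close>

text \<open>Arguments are arbitrary outside \<open>I\<close>, and only values at arguments with
  coordinates in the ring over \<open>I\<close> count. A function of fewer variables can thus be
  read at points with more coordinates.\<close>

definition poly_fun :: "'i set \<Rightarrow> (('i \<Rightarrow> 'a) \<Rightarrow> 'a) \<Rightarrow> bool"
  where "poly_fun I \<phi> \<longleftrightarrow>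
    (\<exists>P\<in>indexed_pset I (carrier R). \<forall>a\<in>I \<rightarrow> carrier R. \<phi> a = mpoly_value R a P)"

lemma poly_fun_value: "P \<in> indexed_pset I (carrier R) \<Longrightarrow> poly_fun I (\<lambda>a. mpoly_value R a P)"
  unfolding poly_fun_def by blast

lemma poly_fun_closed: "\<lbrakk>poly_fun I \<phi>; a \<in> I \<rightarrow> carrier R\<rbrakk> \<Longrightarrow> \<phi> a \<in> carrier R"
  unfolding poly_fun_def using value_closed by metis

lemma poly_fun_const: "k \<in> carrier R \<Longrightarrow> poly_fun I (\<lambda>a. k)"
  unfolding poly_fun_def using indexed_pset.indexed_const value_const by metis

lemma poly_fun_add:
  "\<lbrakk>poly_fun I \<phi>; poly_fun I \<psi>\<rbrakk> \<Longrightarrow> poly_fun I (\<lambda>a. \<phi> a \<oplus> \<psi> a)"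
  unfolding poly_fun_def using indexed_pset.indexed_padd value_padd by metis

lemma poly_fun_mult_var:
  "\<lbrakk>poly_fun I \<phi>; i \<in> I\<rbrakk> \<Longrightarrow> poly_fun I (\<lambda>a. \<phi> a \<otimes> a i)"
  unfolding poly_fun_def using indexed_pset.indexed_pmult value_pmult by metis

lemma poly_fun_cong:
  "\<lbrakk>poly_fun I \<phi>; \<And>a. a \<in> I \<rightarrow> carrier R \<Longrightarrow> \<phi> a = \<psi> a\<rbrakk> \<Longrightarrow> poly_fun I \<psi>"
  unfolding poly_fun_def by metis

text \<open>Induction along the generation of polynomials from constants, sums and multiplication by
  a variable, transferred to functions. The \<open>cong\<close> case is the price for determining a
  function on \<open>I\<close> only.\<close>

lemma poly_fun_induct [consumes 1, case_names cong const add mult_var]: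
  assumes "poly_fun I \<phi>"
    and cong: "\<And>\<phi> \<psi>. \<lbrakk>Q \<phi>; \<And>a. a \<in> I \<rightarrow> carrier R \<Longrightarrow> \<phi> a = \<psi> a\<rbrakk> \<Longrightarrow> Q \<psi>"
    and const: "\<And>k. k \<in> carrier R \<Longrightarrow> Q (\<lambda>a. k)"
    and add: "\<And>\<phi> \<psi>. \<lbrakk>poly_fun I \<phi>; Q \<phi>; poly_fun I \<psi>; Q \<psi>\<rbrakk> \<Longrightarrow> Q (\<lambda>a. \<phi> a \<oplus> \<psi> a)"
    and mult_var: "\<And>\<phi> i. \<lbrakk>poly_fun I \<phi>; Q \<phi>; i \<in> I\<rbrakk> \<Longrightarrow> Q (\<lambda>a. \<phi> a \<otimes> a i)"
  shows "Q \<phi>"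
proof -
  have "Q (\<lambda>a. mpoly_value R a P)" if "P \<in> indexed_pset I (carrier R)" for P
    using that
  proof (induction rule: indexed_pset.induct)
    case (indexed_const k)
    show ?case by (rule cong[OF const[OF indexed_const]]) (simp add: value_const indexed_const)
  next
    case (indexed_padd P P')
    show ?case
      by (rule cong[OF add[OF poly_fun_value indexed_padd.IH(1) poly_fun_value indexed_padd.IH(2)]])
        (use indexed_padd.hyps in \<open>simp_all add: value_padd[where I = I]\<close>)
  next
    case (indexed_pmult P i)
    show ?case
      by (rule cong[OF mult_var[OF poly_fun_value indexed_pmult.IH]])
        (use indexed_pmult.hyps in \<open>simp_all add: value_pmult[where I = I]\<close>)
  qed
  moreover obtain P where "P \<in> indexed_pset I (carrier R)" "\<And>a. a \<in> I \<rightarrow> carrier R \<Longrightarrow> mpoly_value R a P = \<phi> a"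
    using assms(1) unfolding poly_fun_def by metis
  ultimately show ?thesis using cong by blast
qed

text \<open>Induction on the second factor. Its constant case is an induction on the first factor,
  since multiplication by a constant is not among the generating operations.\<close>

lemma poly_fun_mult:
  assumes \<phi>: "poly_fun I \<phi>" and "poly_fun I \<psi>"
  shows "poly_fun I (\<lambda>a. \<phi> a \<otimes> \<psi> a)"
  using assms(2)
proof (induction rule: poly_fun_induct)
  case (cong \<psi> \<psi>')
  then show ?case by (auto elim: poly_fun_cong)
next
  case (const k)
  from \<phi> show ?case
  proof (induction rule: poly_fun_induct)
    case (cong \<psi> \<psi>')
    then show ?case by (auto elim: poly_fun_cong)
  next
    case (const l)
    then show ?case using poly_fun_const[of "l \<otimes> k"] \<open>k \<in> carrier R\<close> by simp
  next
    case (add \<psi> \<psi>')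
    show ?case
    proof (rule poly_fun_cong[OF poly_fun_add[OF add.IH]])
      fix a assume "a \<in> I \<rightarrow> carrier R"
      with add.hyps \<open>k \<in> carrier R\<close> show "\<psi> a \<otimes> k \<oplus> \<psi>' a \<otimes> k = (\<psi> a \<oplus> \<psi>' a) \<otimes> k"
        using poly_fun_closed l_distr by metis
    qed
  next
    case (mult_var \<psi> i)
    show ?case
    proof (rule poly_fun_cong[OF poly_fun_mult_var[OF mult_var.IH \<open>i \<in> I\<close>]])
      fix a assume a: "a \<in> I \<rightarrow> carrier R"
      then have "\<psi> a \<in> carrier R" "a i \<in> carrier R" using poly_fun_closed mult_var.hyps by blast+
      then show "\<psi> a \<otimes> k \<otimes> a i = \<psi> a \<otimes> a i \<otimes> k" using \<open>k \<in> carrier R\<close> by (simp add: m_ac)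
    qed
  qed
next
  case (add \<psi> \<psi>')
  show ?case
  proof (rule poly_fun_cong[OF poly_fun_add[OF add.IH]])
    fix a assume "a \<in> I \<rightarrow> carrier R"
    with add.hyps \<phi> show "\<phi> a \<otimes> \<psi> a \<oplus> \<phi> a \<otimes> \<psi>' a = \<phi> a \<otimes> (\<psi> a \<oplus> \<psi>' a)"
      using poly_fun_closed r_distr by metis
  qed
next
  case (mult_var \<psi> i)
  show ?case
  proof (rule poly_fun_cong[OF poly_fun_mult_var[OF mult_var.IH \<open>i \<in> I\<close>]])
    fix a assume a: "a \<in> I \<rightarrow> carrier R"
    then have "\<psi> a \<in> carrier R" "a i \<in> carrier R" "\<phi> a \<in> carrier R"
      using poly_fun_closed mult_var.hyps \<phi> by blast+
    then show "\<phi> a \<otimes> \<psi> a \<otimes> a i = \<phi> a \<otimes> (\<psi> a \<otimes> a i)" by (simp add: m_assoc)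
  qed
qed

text \<open>Substitution turns the multiplication by the variable \<open>i\<close> into a
  multiplication by \<open>\<gamma> i\<close>, which \<open>poly_fun_mult\<close> permits.\<close>

lemma poly_fun_subst:
  assumes "poly_fun I \<phi>" "\<And>i. i \<in> I \<Longrightarrow> poly_fun J (\<gamma> i)"
    and "\<And>i a. i \<in> I \<Longrightarrow> a \<in> J \<rightarrow> carrier R \<Longrightarrow> g a i = \<gamma> i a"
  shows "poly_fun J (\<lambda>a. \<phi> (g a))"
  using assms(1)
proof (induction rule: poly_fun_induct)
  case (cong \<phi> \<psi>)
  have "g a \<in> I \<rightarrow> carrier R" if "a \<in> J \<rightarrow> carrier R" for a
    using assms(3) poly_fun_closed[OF assms(2)] that by simp
  then show ?case using cong by (intro poly_fun_cong[OF cong(1)]) auto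
next
  case (mult_var \<phi> i)
  show ?case
    by (rule poly_fun_cong[OF poly_fun_mult[OF mult_var.IH assms(2)[OF \<open>i \<in> I\<close>]]])
      (use assms(3) \<open>i \<in> I\<close> in auto)
qed (auto intro: poly_fun_const poly_fun_add)

lemma poly_fun_var: "i \<in> I \<Longrightarrow> poly_fun I (\<lambda>a. a i)"
  by (rule poly_fun_cong[OF poly_fun_mult_var[OF poly_fun_const[of \<one>]]]) (auto simp: Pi_iff)

lemma poly_fun_mono: "\<lbrakk>poly_fun I \<phi>; I \<subseteq> J\<rbrakk> \<Longrightarrow> poly_fun J \<phi>"
  by (rule poly_fun_subst[of I \<phi> J "\<lambda>i a. a i" "\<lambda>a. a", simplified]) (auto intro: poly_fun_var)

lemma poly_fun_minus:
  assumes "poly_fun I \<phi>" "poly_fun I \<psi>"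
  shows "poly_fun I (\<lambda>a. \<phi> a \<ominus> \<psi> a)"
proof (rule poly_fun_cong[OF poly_fun_add[OF assms(1) poly_fun_mult[OF poly_fun_const assms(2)]]])
  fix a assume "a \<in> I \<rightarrow> carrier R"
  then have "\<phi> a \<in> carrier R" "\<psi> a \<in> carrier R" using assms poly_fun_closed by blast+
  then show "\<phi> a \<oplus> \<ominus> \<one> \<otimes> \<psi> a = \<phi> a \<ominus> \<psi> a" by (simp add: minus_eq l_minus)
qed simp

lemma poly_fun_finsum:
  assumes "finite A" "\<And>c. c \<in> A \<Longrightarrow> poly_fun I (f c)"
  shows "poly_fun I (\<lambda>a. \<Oplus>c\<in>A. f c a)"
  using assms
proof (induction A)
  case (insert c A)
  have "poly_fun I (f c)" "poly_fun I (\<lambda>a. \<Oplus>c\<in>A. f c a)" using insert by simp_all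
  from poly_fun_add[OF this] show ?case
  proof (rule poly_fun_cong)
    fix a assume "a \<in> I \<rightarrow> carrier R"
    then have "f c' a \<in> carrier R" if "c' \<in> insert c A" for c'
      using poly_fun_closed[OF insert.prems[OF that]] by blast
    then show "f c a \<oplus> (\<Oplus>c\<in>A. f c a) = (\<Oplus>c\<in>insert c A. f c a)"
      using insert.hyps by (simp add: Pi_iff)
  qed
qed (simp add: poly_fun_const)

lemma poly_fun_finprod:
  assumes "finite A" "\<And>c. c \<in> A \<Longrightarrow> poly_fun I (f c)"
  shows "poly_fun I (\<lambda>a. \<Otimes>c\<in>A. f c a)"
  using assms
proof (induction A)
  case (insert c A)
  have "poly_fun I (f c)" "poly_fun I (\<lambda>a. \<Otimes>c\<in>A. f c a)" using insert by simp_all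
  from poly_fun_mult[OF this] show ?case
  proof (rule poly_fun_cong)
    fix a assume "a \<in> I \<rightarrow> carrier R"
    then have "f c' a \<in> carrier R" if "c' \<in> insert c A" for c'
      using poly_fun_closed[OF insert.prems[OF that]] by blast
    then show "f c a \<otimes> (\<Otimes>c\<in>A. f c a) = (\<Otimes>c\<in>insert c A. f c a)"
      using insert.hyps by (simp add: Pi_iff)
  qed
qed (simp add: poly_fun_const)

lemma poly_fun_pow: "poly_fun I \<phi> \<Longrightarrow> poly_fun I (\<lambda>a. \<phi> a [^] (k::nat))"
  by (induction k) (auto intro: poly_fun_const poly_fun_mult)

text \<open>Together with the restricted set of variables, this is what makes the digits triangular.
  The product step is \<open>a b - a' b' = (a - a') b + a' (b - b')\<close>.\<close>

lemma poly_fun_ideal_cong: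
  assumes "ideal A R" "poly_fun I \<phi>" "a \<in> I \<rightarrow> carrier R" "b \<in> I \<rightarrow> carrier R"
    and "\<And>i. i \<in> I \<Longrightarrow> a i \<ominus> b i \<in> A"
  shows "\<phi> a \<ominus> \<phi> b \<in> A"
proof -
  interpret A: ideal A R by fact
  show ?thesis using assms(2)
  proof (induction rule: poly_fun_induct)
    case (cong \<phi> \<psi>)
    then show ?case using assms(3,4) by simp
  next
    case (const k)
    then show ?case by (simp add: r_neg a_minus_def)
  next
    case (add \<phi> \<psi>)
    have cl: "\<phi> a \<in> carrier R" "\<phi> b \<in> carrier R" "\<psi> a \<in> carrier R" "\<psi> b \<in> carrier R"
      using add assms(3,4) poly_fun_closed by blast+
    then have "(\<phi> a \<oplus> \<psi> a) \<ominus> (\<phi> b \<oplus> \<psi> b) = (\<phi> a \<ominus> \<phi> b) \<oplus> (\<psi> a \<ominus> \<psi> b)"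
      by algebra
    then show ?case using add by simp
  next
    case (mult_var \<phi> i)
    have cl: "\<phi> a \<in> carrier R" "\<phi> b \<in> carrier R" "a i \<in> carrier R" "b i \<in> carrier R"
      using mult_var assms(3,4) poly_fun_closed by blast+
    then have "\<phi> a \<otimes> a i \<ominus> \<phi> b \<otimes> b i = (\<phi> a \<ominus> \<phi> b) \<otimes> a i \<oplus> \<phi> b \<otimes> (a i \<ominus> b i)"
      by algebra
    then show ?case using mult_var cl assms(5) A.I_l_closed A.I_r_closed by simp
  qed
qed

end

section \<open>Finite local rings\<close>

locale finite_local_ring = cring R for R (structure) +
  fixes M :: "'a set"
  assumes maximalideal_M: "maximalideal M R"
    and unique_maximalideal: "maximalideal J R \<Longrightarrow> J = M"
    and finite_carrier: "finite (carrier R)"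
begin

sublocale M: maximalideal M R by (rule maximalideal_M)

lemma one_notin_M: "\<one> \<notin> M"
  using M.one_imp_carrier M.I_notcarr by blast

text \<open>Finiteness provides a maximal element among the proper ideals above \<open>I\<close>,
  and \<open>M\<close> is the only candidate.\<close>

lemma proper_ideal_subset_M:
  assumes "ideal I R" "I \<noteq> carrier R" shows "I \<subseteq> M"
proof -
  let ?F = "{J. ideal J R \<and> I \<subseteq> J \<and> J \<noteq> carrier R}"
  have sub: "J \<subseteq> carrier R" if "ideal J R" for J
    using that ideal.axioms(1) additive_subgroup.a_subset by blast
  have "finite ?F" by (rule finite_subset[of _ "Pow (carrier R)"]) (use sub finite_carrier in auto)
  moreover have "I \<in> ?F" using assms by simp
  ultimately obtain J where J: "J \<in> ?F" and max: "\<And>K. K \<in> ?F \<Longrightarrow> J \<subseteq> K \<Longrightarrow> K = J"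
    using finite_has_maximal[of ?F] by (metis (no_types, lifting) empty_iff)
  have "maximalideal J R"
  proof (rule maximalidealI)
    show "ideal J R" "carrier R \<noteq> J" using J by auto
    show "K = J \<or> K = carrier R" if "ideal K R" "J \<subseteq> K" "K \<subseteq> carrier R" for K
      using max[of K] that J by blast
  qed
  then show ?thesis using J unique_maximalideal by blast
qed

lemma Units_iff: "x \<in> carrier R \<Longrightarrow> x \<in> Units R \<longleftrightarrow> x \<notin> M"
proof
  assume x: "x \<in> carrier R" and "x \<notin> M"
  then have "PIdl x = carrier R"
    using proper_ideal_subset_M[OF cgenideal_ideal[OF x]] cgenideal_self[OF x] by blast
  then obtain y where "y \<in> carrier R" "\<one> = y \<otimes> x" unfolding cgenideal_def by auto
  then show "x \<in> Units R" using x m_comm unfolding Units_def by auto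
next
  assume "x \<in> Units R"
  then show "x \<notin> M"
    using M.I_l_closed[of x "inv x"] one_notin_M Units_l_inv Units_inv_closed by auto
qed

lemma Units_if_diff: "\<lbrakk>x \<in> carrier R; y \<in> Units R; x \<ominus> y \<in> M\<rbrakk> \<Longrightarrow> x \<in> Units R"
proof -
  assume x: "x \<in> carrier R" and y: "y \<in> Units R" and d: "x \<ominus> y \<in> M"
  have yc: "y \<in> carrier R" using y by auto
  have "x \<ominus> (x \<ominus> y) \<in> M" if "x \<in> M"
    using that d by (simp add: a_minus_def)
  moreover have "x \<ominus> (x \<ominus> y) = y" using x yc by algebra
  ultimately show ?thesis using Units_iff x yc y by auto
qed

lemma Units_cancel_left: "\<lbrakk>u \<in> Units R; x \<in> carrier R\<rbrakk> \<Longrightarrow> inv u \<otimes> (u \<otimes> x) = x"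
  using m_assoc[of "inv u" u x] by auto

section \<open>Residue classes and their numbering\<close>

definition q :: nat
  where "q = order (R Quot M)"

lemma finite_Quot: "finite (carrier (R Quot M))"
  using finite_carrier by (simp add: FactRing_def A_RCOSETS_def RCOSETS_def)

text \<open>The classes are numbered from \<open>1\<close> so that \<open>sym_group q\<close>
  permutes their numbers.\<close>

definition class_index :: "'a set \<Rightarrow> nat"
  where "class_index = (SOME f. bij_betw f (carrier (R Quot M)) {1..q})"

definition residue :: "'a \<Rightarrow> nat"
  where "residue x = class_index (M +> x)"

lemma class_index_bij: "bij_betw class_index (carrier (R Quot M)) {1..q}"
proof -
  have "card (carrier (R Quot M)) = card {1..q}" unfolding q_def order_def by simp
  then have "\<exists>f. bij_betw f (carrier (R Quot M)) {1..q}"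
    by (rule finite_same_card_bij[OF finite_Quot finite_atLeastAtMost])
  then show ?thesis unfolding class_index_def by (rule someI_ex)
qed

lemma Quot_carrier: "carrier (R Quot M) = (\<lambda>x. M +> x) ` carrier R"
  unfolding FactRing_def A_RCOSETS_def' by auto

lemma residue_eq_iff:
  assumes "x \<in> carrier R" "y \<in> carrier R"
  shows "residue x = residue y \<longleftrightarrow> x \<ominus> y \<in> M"
proof -
  have "residue x = residue y \<longleftrightarrow> M +> x = M +> y"
    using inj_on_eq_iff[OF bij_betw_imp_inj_on[OF class_index_bij], of "M +> x" "M +> y"] assms
    unfolding residue_def by (simp add: Quot_carrier)
  also have "\<dots> \<longleftrightarrow> x \<ominus> y \<in> M"
    using quotient_eq_iff_same_a_r_cos[OF M.is_ideal assms] by simp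
  finally show ?thesis .
qed

lemma residue_range: "x \<in> carrier R \<Longrightarrow> residue x \<in> {1..q}"
proof -
  assume x: "x \<in> carrier R"
  have "M +> x \<in> carrier (R Quot M)" using x Quot_carrier by blast
  then show ?thesis unfolding residue_def by (rule bij_betw_apply[OF class_index_bij])
qed

lemma residue_surj: "v \<in> {1..q} \<Longrightarrow> \<exists>x\<in>carrier R. residue x = v"
proof -
  assume v: "v \<in> {1..q}"
  then have "v \<in> class_index ` (\<lambda>x. M +> x) ` carrier R"
    using class_index_bij by (simp add: bij_betw_def Quot_carrier)
  then show ?thesis by (auto simp: residue_def)
qed

lemma q_ge_2: "q \<ge> 2"
proof -
  have "residue \<zero> \<noteq> residue \<one>"
    using residue_eq_iff[of \<one> \<zero>] one_notin_M by (simp add: a_minus_def)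
  then show ?thesis using residue_range[of \<zero>] residue_range[of \<one>] by auto
qed

definition rep :: "nat \<Rightarrow> 'a"
  where "rep v = (SOME x. x \<in> carrier R \<and> residue x = v)"

lemma rep: assumes "v \<in> {1..q}" shows "rep v \<in> carrier R" "residue (rep v) = v"
  using someI_ex[of "\<lambda>x. x \<in> carrier R \<and> residue x = v"] residue_surj[OF assms]
  unfolding rep_def by blast+

section \<open>Digits from a chain of ideals\<close>

text \<open>Take \<open>J\<close> maximal among the ideals properly below \<open>I\<close>; then any
  element of \<open>I\<close> outside \<open>J\<close> spans \<open>I\<close> modulo
  \<open>J\<close>. If \<open>m a\<close> were outside \<open>J\<close>, it would span
  \<open>a\<close>, so \<open>(1 - r m) a\<close> would lie in \<open>J\<close> for some
  \<open>r\<close>; but \<open>1 - r m\<close> is a unit.\<close>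

lemma ideal_refinement:
  assumes I: "ideal I R" and "I \<noteq> {\<zero>}"
  obtains J a where "ideal J R" "J \<subset> I" "a \<in> I" "a \<notin> J"
    "\<And>m. m \<in> M \<Longrightarrow> m \<otimes> a \<in> J" "\<And>y. y \<in> I \<Longrightarrow> \<exists>r\<in>carrier R. y \<ominus> r \<otimes> a \<in> J"
proof -
  have sub: "K \<subseteq> carrier R" if "ideal K R" for K
    using that ideal.axioms(1) additive_subgroup.a_subset by blast
  let ?F = "{J. ideal J R \<and> J \<subset> I}"
  have "finite ?F" by (rule finite_subset[of _ "Pow (carrier R)"]) (use sub finite_carrier in auto)
  moreover have "{\<zero>} \<in> ?F"
    using assms zeroideal ideal.axioms(1)[OF I] additive_subgroup.zero_closed by fastforce
  ultimately obtain J where J: "J \<in> ?F" and max: "\<And>K. K \<in> ?F \<Longrightarrow> J \<subseteq> K \<Longrightarrow> K = J"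
    using finite_has_maximal[of ?F] by (metis (no_types, lifting) empty_iff)
  interpret I: ideal I R by fact
  interpret J: ideal J R using J by simp
  obtain a where a: "a \<in> I" "a \<notin> J" using J by blast
  have ac: "a \<in> carrier R" using a sub[OF I] by blast
  have span: "\<exists>r\<in>carrier R. y \<ominus> r \<otimes> b \<in> J" if b: "b \<in> I" "b \<notin> J" and y: "y \<in> I" for b y
  proof -
    have bc: "b \<in> carrier R" using b sub[OF I] by blast
    let ?K = "J <+>\<^bsub>R\<^esub> PIdl b"
    have K: "ideal ?K R" by (rule add_ideals[OF J.is_ideal cgenideal_ideal[OF bc]])
    have Kin: "x \<in> ?K \<longleftrightarrow> (\<exists>j\<in>J. \<exists>r\<in>carrier R. x = j \<oplus> r \<otimes> b)" for x
      unfolding set_add_def set_mult_def cgenideal_def by auto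
    have "b \<in> ?K" unfolding Kin using bc J.zero_closed by (intro bexI[of _ \<zero>] bexI[of _ \<one>]) auto
    moreover have "J \<subseteq> ?K"
    proof
      fix j assume "j \<in> J"
      then show "j \<in> ?K" unfolding Kin using bc by (intro bexI[of _ j] bexI[of _ \<zero>]) auto
    qed
    moreover have "?K \<subseteq> I"
    proof
      fix x assume "x \<in> ?K"
      then show "x \<in> I" unfolding Kin using b J I.I_l_closed I.a_closed by blast
    qed
    ultimately have "?K = I" using max[of ?K] K b by blast
    then obtain j r where jr: "j \<in> J" "r \<in> carrier R" "y = j \<oplus> r \<otimes> b" using y Kin by blast
    have "y \<ominus> r \<otimes> b = j" using jr bc J.Icarr unfolding jr(3) by algebra
    then show ?thesis using jr(1,2) by metis
  qed
  have "m \<otimes> a \<in> J" if m: "m \<in> M" for m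
  proof (rule ccontr)
    assume ma: "m \<otimes> a \<notin> J"
    have mc: "m \<in> carrier R" using m M.Icarr by blast
    have "m \<otimes> a \<in> I" using mc a I.I_l_closed by blast
    from span[OF this ma a(1)] obtain r where r: "r \<in> carrier R" "a \<ominus> r \<otimes> (m \<otimes> a) \<in> J" by blast
    let ?u = "\<one> \<ominus> r \<otimes> m"
    have "?u \<ominus> \<one> = \<ominus> (r \<otimes> m)" using r mc by algebra
    then have "?u \<in> Units R" using Units_if_diff[of ?u \<one>] m M.I_l_closed r mc by simp
    moreover have "?u \<otimes> a \<in> J" using r mc ac by (simp add: a_minus_def l_distr l_minus m_assoc)
    ultimately have "inv ?u \<otimes> (?u \<otimes> a) \<in> J" using J.I_l_closed by blast
    moreover have "inv ?u \<otimes> (?u \<otimes> a) = a"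
      using Units_cancel_left[OF \<open>?u \<in> Units R\<close> ac] .
    ultimately show False using a by simp
  qed
  then show ?thesis using that[of J a] J a span[OF a] J.is_ideal by blast
qed

text \<open>Modulo \<open>J\<close> the ideal \<open>I\<close> is a line over the residue field with
  basis \<open>a\<close>. Write \<open>x\<close> as a chosen representative \<open>c x\<close> of
  its class modulo \<open>I\<close> plus a multiple \<open>r x\<close> of \<open>a\<close> modulo
  \<open>J\<close>; the digit is the residue of \<open>r x\<close>. Digits are meaningful only
  inside one class modulo \<open>I\<close>, where \<open>c\<close> is constant.\<close>

lemma ideal_digit:
  assumes I: "ideal I R" and J: "ideal J R" "J \<subseteq> I" and a: "a \<in> I" "a \<notin> J"
    and Ma: "\<And>m. m \<in> M \<Longrightarrow> m \<otimes> a \<in> J"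
    and span: "\<And>y. y \<in> I \<Longrightarrow> \<exists>r\<in>carrier R. y \<ominus> r \<otimes> a \<in> J"
  obtains t where "\<And>x. x \<in> carrier R \<Longrightarrow> t x \<in> {1..q}"
    "\<And>x y. \<lbrakk>x \<in> carrier R; y \<in> carrier R; x \<ominus> y \<in> I\<rbrakk> \<Longrightarrow> t x = t y \<longleftrightarrow> x \<ominus> y \<in> J"
proof -
  interpret I: ideal I R by fact
  interpret J: ideal J R by fact
  have ac: "a \<in> carrier R" using a I.Icarr by blast
  define c where "c y = (SOME z. z \<in> carrier R \<and> y \<ominus> z \<in> I)" for y
  have c: "c y \<in> carrier R" "y \<ominus> c y \<in> I" if "y \<in> carrier R" for y
  proof -
    have "y \<ominus> y \<in> I" using that by (simp add: a_minus_def r_neg)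
    then show "c y \<in> carrier R" "y \<ominus> c y \<in> I"
      using someI_ex[of "\<lambda>z. z \<in> carrier R \<and> y \<ominus> z \<in> I"] that unfolding c_def by blast+
  qed
  have c_eq: "c x = c y" if "x \<in> carrier R" "y \<in> carrier R" "x \<ominus> y \<in> I" for x y
  proof -
    have "x \<ominus> z \<in> I \<longleftrightarrow> y \<ominus> z \<in> I" if z: "z \<in> carrier R" for z
    proof -
      have "x \<ominus> z = (x \<ominus> y) \<oplus> (y \<ominus> z)" "y \<ominus> z = (x \<ominus> z) \<oplus> \<ominus> (x \<ominus> y)"
        using z \<open>x \<in> carrier R\<close> \<open>y \<in> carrier R\<close> by algebra+
      then show ?thesis using \<open>x \<ominus> y \<in> I\<close> I.a_closed I.a_inv_closed by metis
    qed
    then have "(\<lambda>z. z \<in> carrier R \<and> x \<ominus> z \<in> I) = (\<lambda>z. z \<in> carrier R \<and> y \<ominus> z \<in> I)" by auto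
    then show ?thesis by (simp add: c_def)
  qed
  define r where "r y = (SOME r. r \<in> carrier R \<and> (y \<ominus> c y) \<ominus> r \<otimes> a \<in> J)" for y
  have r: "r y \<in> carrier R" "(y \<ominus> c y) \<ominus> r y \<otimes> a \<in> J" if "y \<in> carrier R" for y
    using someI_ex[of "\<lambda>r. r \<in> carrier R \<and> (y \<ominus> c y) \<ominus> r \<otimes> a \<in> J"] span[OF c(2)[OF that]]
    unfolding r_def by blast+
  have Ja: "s \<otimes> a \<in> J \<longleftrightarrow> s \<in> M" if s: "s \<in> carrier R" for s
  proof
    assume sa: "s \<otimes> a \<in> J"
    show "s \<in> M"
    proof (rule ccontr)
      assume "s \<notin> M"
      then have u: "s \<in> Units R" using Units_iff s by simp
      then have "inv s \<otimes> (s \<otimes> a) \<in> J" using sa J.I_l_closed by blast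
      then show False using Units_cancel_left[OF u ac] a by simp
    qed
  qed (rule Ma)
  show ?thesis
  proof (rule that[of "\<lambda>y. residue (r y)"])
    show "residue (r x) \<in> {1..q}" if "x \<in> carrier R" for x
      using r(1)[OF that] residue_range by blast
    fix x y assume x: "x \<in> carrier R" and y: "y \<in> carrier R" and xy: "x \<ominus> y \<in> I"
    define e where "e z = (z \<ominus> c z) \<ominus> r z \<otimes> a" for z
    have e: "e x \<in> J" "e y \<in> J" using r(2) x y by (auto simp: e_def)
    have cc: "e x \<in> carrier R" "e y \<in> carrier R" using e J.Icarr by blast+
    have "x \<ominus> y = (r x \<ominus> r y) \<otimes> a \<oplus> (e x \<ominus> e y)"
      unfolding e_def c_eq[OF x y xy] using x y r(1) c(1) ac by algebra
    moreover have "(r x \<ominus> r y) \<otimes> a = (x \<ominus> y) \<oplus> (e y \<ominus> e x)"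
      unfolding e_def c_eq[OF x y xy] using x y r(1) c(1) ac by algebra
    moreover have "e x \<ominus> e y \<in> J" "e y \<ominus> e x \<in> J" using e by (simp_all add: a_minus_def)
    ultimately have "x \<ominus> y \<in> J \<longleftrightarrow> (r x \<ominus> r y) \<otimes> a \<in> J" using J.a_closed by metis
    then show "residue (r x) = residue (r y) \<longleftrightarrow> x \<ominus> y \<in> J"
      using residue_eq_iff r(1) x y Ja by simp
  qed
qed

text \<open>The last clause is the essential one: within a class modulo \<open>I\<close>, agreement
  of leading digits is congruence modulo an ideal, hence is respected by polynomial
  functions.\<close>

definition digit_system :: "'a set \<Rightarrow> nat \<Rightarrow> (nat \<Rightarrow> 'a \<Rightarrow> nat) \<Rightarrow> bool"
  where "digit_system I N t \<longleftrightarrow>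
    (\<forall>k<N. \<forall>x\<in>carrier R. t k x \<in> {1..q}) \<and>
    (\<forall>x\<in>carrier R. \<forall>y\<in>carrier R. x \<ominus> y \<in> I \<longrightarrow> (\<forall>k<N. t k x = t k y) \<longrightarrow> x = y) \<and>
    (\<forall>k\<le>N. \<exists>A. ideal A R \<and> (\<forall>x\<in>carrier R. \<forall>y\<in>carrier R.
       x \<ominus> y \<in> I \<and> (\<forall>j<k. t j x = t j y) \<longleftrightarrow> x \<ominus> y \<in> A))"

lemma digit_system_zero: "digit_system {\<zero>} 0 t"
proof -
  have "x = y" if "x \<in> carrier R" "y \<in> carrier R" "x \<ominus> y = \<zero>" for x y
    using that by (simp add: r_right_minus_eq)
  then show ?thesis unfolding digit_system_def using zeroideal by auto
qed

text \<open>The new digit is the coarsest and goes in front: within a class modulo \<open>I\<close>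
  it determines the class modulo \<open>J\<close>, where the old digits, shifted by one place, take
  over.\<close>

lemma digit_system_Suc:
  assumes I: "ideal I R" and J: "J \<subseteq> I" and t: "digit_system J N t"
    and t0_range: "\<And>x. x \<in> carrier R \<Longrightarrow> t0 x \<in> {1..q}"
    and t0: "\<And>x y. \<lbrakk>x \<in> carrier R; y \<in> carrier R; x \<ominus> y \<in> I\<rbrakk> \<Longrightarrow> t0 x = t0 y \<longleftrightarrow> x \<ominus> y \<in> J"
  shows "digit_system I (Suc N) (case_nat t0 t)"
proof -
  let ?t = "case_nat t0 t"
  have step: "x \<ominus> y \<in> I \<and> (\<forall>j<Suc k. ?t j x = ?t j y) \<longleftrightarrow> x \<ominus> y \<in> J \<and> (\<forall>j<k. t j x = t j y)"
    if "x \<in> carrier R" "y \<in> carrier R" for x y k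
  proof (cases "x \<ominus> y \<in> I")
    case True
    then show ?thesis unfolding All_less_Suc2 using t0[OF that] by simp
  next
    case False
    then show ?thesis using J by blast
  qed
  show ?thesis unfolding digit_system_def
  proof (intro conjI allI ballI impI)
    fix k x assume k: "k < Suc N" and x: "x \<in> carrier R"
    show "?t k x \<in> {1..q}"
      using t0_range[OF x] t k x unfolding digit_system_def by (cases k) simp_all
  next
    fix x y assume x: "x \<in> carrier R" and y: "y \<in> carrier R"
      and "x \<ominus> y \<in> I" "\<forall>k<Suc N. ?t k x = ?t k y"
    then have "x \<ominus> y \<in> J \<and> (\<forall>k<N. t k x = t k y)" using step[OF x y, of N] by simp
    then show "x = y" using t x y unfolding digit_system_def by simp
  next
    fix k assume k: "k \<le> Suc N"
    show "\<exists>A. ideal A R \<and> (\<forall>x\<in>carrier R. \<forall>y\<in>carrier R.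
      x \<ominus> y \<in> I \<and> (\<forall>j<k. ?t j x = ?t j y) \<longleftrightarrow> x \<ominus> y \<in> A)"
    proof (cases k)
      case 0
      then show ?thesis using I by auto
    next
      case (Suc k')
      then obtain A where "ideal A R" "\<forall>x\<in>carrier R. \<forall>y\<in>carrier R.
        x \<ominus> y \<in> J \<and> (\<forall>j<k'. t j x = t j y) \<longleftrightarrow> x \<ominus> y \<in> A"
        using t k unfolding digit_system_def by auto
      then show ?thesis unfolding Suc by (intro exI[of _ A]) (simp add: step)
    qed
  qed
qed

lemma exists_digit_system:
  assumes "ideal I R" shows "\<exists>N t. digit_system I N t"
  using assms
proof (induction "card I" arbitrary: I rule: less_induct)
  case less
  show ?case
  proof (cases "I = {\<zero>}")
    case True
    then show ?thesis using digit_system_zero by blast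
  next
    case False
    obtain J a where J: "ideal J R" "J \<subset> I" and a: "a \<in> I" "a \<notin> J"
      "\<And>m. m \<in> M \<Longrightarrow> m \<otimes> a \<in> J" "\<And>y. y \<in> I \<Longrightarrow> \<exists>r\<in>carrier R. y \<ominus> r \<otimes> a \<in> J"
      by (rule ideal_refinement[OF less.prems False]) (rule that)
    have JI: "J \<subseteq> I" using J by blast
    obtain t0 where t0: "\<And>x. x \<in> carrier R \<Longrightarrow> t0 x \<in> {1..q}"
      "\<And>x y. \<lbrakk>x \<in> carrier R; y \<in> carrier R; x \<ominus> y \<in> I\<rbrakk> \<Longrightarrow> t0 x = t0 y \<longleftrightarrow> x \<ominus> y \<in> J"
      by (rule ideal_digit[OF less.prems J(1) JI a]) (assumption, assumption, rule that)
    have "finite I"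
      using less.prems finite_carrier additive_subgroup.a_subset ideal.axioms(1) finite_subset by metis
    then have "card J < card I" using J(2) psubset_card_mono by blast
    from less.hyps[OF this J(1)] obtain N t where "digit_system J N t" by blast
    then have "digit_system I (Suc N) (case_nat t0 t)"
      by (rule digit_system_Suc[OF less.prems JI]) (use t0 in blast)+
    then show ?thesis by blast
  qed
qed

section \<open>Indicators of residue classes as polynomial functions\<close>

text \<open>If \<open>y - c\<close> is a unit, then one of the factors vanishes; if it lies in the maximal ideal, then
  all factors are units.\<close>

definition class_indicator :: "'a \<Rightarrow> 'a \<Rightarrow> 'a"
  where "class_indicator c y = (\<Otimes>u\<in>Units R. (y \<ominus> c) \<ominus> u) [^] card (Units R)"

lemma finite_Units: "finite (Units R)"
  using finite_carrier finite_subset Units_closed by (metis subsetI)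

text \<open>Lagrange's theorem in the unit group. The exponent in \<open>class_indicator\<close>
  turns a unit into exactly \<open>1\<close>, so that the indicator takes only the values
  \<open>0\<close> and \<open>1\<close>.\<close>

lemma unit_pow: "u \<in> Units R \<Longrightarrow> u [^] card (Units R) = \<one>"
proof -
  assume u: "u \<in> Units R"
  interpret U: group "units_of R" by (rule units_group)
  have "u [^]\<^bsub>units_of R\<^esub> order (units_of R) = \<one>\<^bsub>units_of R\<^esub>"
    using U.pow_order_eq_1[of u] u by (simp add: units_of_carrier)
  then show ?thesis using units_of_pow[OF u] by (simp add: units_of_carrier units_of_one order_def)
qed

lemma Units_finprod: "finite A \<Longrightarrow> (\<And>u. u \<in> A \<Longrightarrow> f u \<in> Units R) \<Longrightarrow> (\<Otimes>u\<in>A. f u) \<in> Units R"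
proof (induction A rule: finite_induct)
  case (insert x A)
  then show ?case by (subst finprod_insert) (auto simp: Pi_iff)
qed simp

lemma finprod_zero:
  assumes "finite A" "u \<in> A" "f u = \<zero>" "f \<in> A \<rightarrow> carrier R" shows "(\<Otimes>u\<in>A. f u) = \<zero>"
proof -
  have "(\<Otimes>u\<in>A. f u) = (\<Otimes>u\<in>insert u (A - {u}). f u)" using assms(2) by (simp add: insert_absorb)
  also have "\<dots> = f u \<otimes> (\<Otimes>u\<in>A - {u}. f u)"
    using assms by (subst finprod_insert) auto
  also have "\<dots> = \<zero>" using assms by (simp add: finprod_closed Pi_iff)
  finally show ?thesis .
qed

lemma class_indicator:
  assumes c: "c \<in> carrier R" and y: "y \<in> carrier R"
  shows "class_indicator c y = (if residue y = residue c then \<one> else \<zero>)"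
proof (cases "residue y = residue c")
  case True
  then have yc: "y \<ominus> c \<in> M" using residue_eq_iff c y by simp
  have "(y \<ominus> c) \<ominus> u \<in> Units R" if u: "u \<in> Units R" for u
  proof -
    have uc: "u \<in> carrier R" using u by auto
    have "(y \<ominus> c) \<ominus> ((y \<ominus> c) \<ominus> u) \<in> M" if "(y \<ominus> c) \<ominus> u \<in> M"
      using yc that by (simp add: a_minus_def)
    moreover have "(y \<ominus> c) \<ominus> ((y \<ominus> c) \<ominus> u) = u" using uc c y by algebra
    ultimately show ?thesis using Units_iff u uc c y by auto
  qed
  then show ?thesis unfolding class_indicator_def using True unit_pow Units_finprod[OF finite_Units] by simp
next
  case False
  \<comment> \<open>The vanishing factor is the one for the unit \<open>u = y - c\<close>.\<close>
  then have "y \<ominus> c \<in> Units R" using residue_eq_iff Units_iff c y by simp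
  moreover have "(y \<ominus> c) \<ominus> (y \<ominus> c) = \<zero>" using c y by algebra
  ultimately have "(\<Otimes>u\<in>Units R. (y \<ominus> c) \<ominus> u) = \<zero>"
    using c y by (intro finprod_zero[OF finite_Units]) auto
  moreover have "card (Units R) > 0" using finite_Units Units_one_closed card_gt_0_iff by blast
  ultimately show ?thesis unfolding class_indicator_def using False by (simp add: nat_pow_zero)
qed

lemma poly_fun_class_indicator:
  assumes "c \<in> carrier R" "i \<in> I" shows "poly_fun I (\<lambda>a. class_indicator c (a i))"
  unfolding class_indicator_def
  by (intro poly_fun_pow poly_fun_finprod finite_Units poly_fun_minus poly_fun_var poly_fun_const)
    (use assms in auto)

end

section \<open>The permutation group of the monoid\<close>

lemma finite_submultisets: "finite {k. k \<subseteq># m}"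
proof (induction m)
  case (add x m)
  have "{k. k \<subseteq># add_mset x m} \<subseteq> {k. k \<subseteq># m} \<union> add_mset x ` {k. k \<subseteq># m}"
  proof
    fix k assume k: "k \<in> {k. k \<subseteq># add_mset x m}"
    show "k \<in> {k. k \<subseteq># m} \<union> add_mset x ` {k. k \<subseteq># m}"
    proof (cases "x \<in># k")
      case True
      then obtain l where "k = add_mset x l" by (blast dest: multi_member_split)
      then show ?thesis using k by auto
    next
      case False
      have "count k a \<le> count m a" for a
        using False mset_subset_eq_count[of k "add_mset x m" a] k
        by (cases "a = x") (simp_all add: not_in_iff)
      then show ?thesis by (simp add: mset_subset_eqI)
    qed
  qed
  then show ?case using add finite_subset by blast
qed simp

context cring begin

lemma mpoly_ring_simps:
  "carrier (mpoly_ring R I) = indexed_pset I (carrier R)"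
  "add (mpoly_ring R I) = indexed_padd"
  by (simp_all add: mpoly_ring_def)

text \<open>In the convolution only the divisor \<open>{#i#}\<close> contributes. This identifies
  the products in the monoid entries with the generating operation
  \<open>indexed_pmult\<close>.\<close>

lemma mpoly_ring_var_mult:
  assumes "\<And>m. P m \<in> carrier R"
  shows "indexed_var i \<otimes>\<^bsub>mpoly_ring R I\<^esub> P = indexed_pmult P i"
proof
  fix m
  let ?f = "\<lambda>k. indexed_var i k \<otimes> P (m - k)"
  have var: "indexed_var i k = (if k = {#i#} then \<one> else \<zero>)" for k
    by (auto simp: indexed_var_def indexed_pmult_def indexed_const_def
        dest: multi_member_split)
  have "(\<Oplus>k\<in>{k. k \<subseteq># m}. ?f k) = indexed_pmult P i m"
  proof (cases "i \<in># m")
    case True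
    have "(\<Oplus>k\<in>{k. k \<subseteq># m}. ?f k)
      = (\<Oplus>k\<in>{k. k \<subseteq># m}. if {#i#} = k then P (m - k) else \<zero>)"
      using assms by (intro finsum_cong') (auto simp: var)
    also have "\<dots> = P (m - {#i#})"
      using True assms by (intro add.finprod_singleton) (auto simp: finite_submultisets)
    finally show ?thesis using True by (simp add: indexed_pmult_def)
  next
    case False
    then have "?f k = \<zero>" if "k \<in> {k. k \<subseteq># m}" for k
      using that assms by (auto simp: var)
    then have "(\<Oplus>k\<in>{k. k \<subseteq># m}. ?f k) = (\<Oplus>k\<in>{k. k \<subseteq># m}. \<zero>)"
      by (intro finsum_cong') auto
    then show ?thesis using False by (simp add: indexed_pmult_def)
  qed
  then show "(indexed_var i \<otimes>\<^bsub>mpoly_ring R I\<^esub> P) m = indexed_pmult P i m"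
    by (simp add: mpoly_ring_def)
qed

lemma pset_mono: "\<lbrakk>P \<in> indexed_pset I K; I \<subseteq> J\<rbrakk> \<Longrightarrow> P \<in> indexed_pset J K"
  by (induction rule: indexed_pset.induct) (auto intro: indexed_pset.intros)

lemma poly_fun_dependency:
  assumes "poly_fun I \<phi>" "a \<in> I \<rightarrow> carrier R" "\<And>i. i \<in> I \<Longrightarrow> a i = b i"
  shows "\<phi> a = \<phi> b"
proof -
  obtain P where P: "P \<in> indexed_pset I (carrier R)"
    and eq: "\<And>a. a \<in> I \<rightarrow> carrier R \<Longrightarrow> \<phi> a = mpoly_value R a P"
    using assms(1) unfolding poly_fun_def by metis
  have "b \<in> I \<rightarrow> carrier R" using assms(2,3) by (metis Pi_iff)
  then show ?thesis using eq assms(2) value_cong[OF P assms(2,3)] by simp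
qed

text \<open>The condition on the entry \<open>i\<close> expressed for the induced function alone, so
  that the group can be studied without composing formal polynomials.\<close>

definition MT_coord :: "nat \<Rightarrow> ((nat \<Rightarrow> 'a) \<Rightarrow> 'a) \<Rightarrow> bool"
  where "MT_coord i h \<longleftrightarrow>
    (if i = 1 then poly_fun {1} h \<and> bij_betw (\<lambda>r. h (\<lambda>_. r)) (carrier R) (carrier R)
     else \<exists>f u. poly_fun {1..i-1} f \<and> poly_fun {1..i-1} u \<and>
       (\<forall>a\<in>{1..i-1} \<rightarrow> carrier R. u a \<in> Units R) \<and>
       (\<forall>a\<in>{1..i} \<rightarrow> carrier R. h a = f a \<oplus> a i \<otimes> u a))"

lemma MT_coord_Suc:
  assumes "i \<ge> 2" "poly_fun {1..i-1} f" "poly_fun {1..i-1} u"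
    "\<And>a. a \<in> {1..i-1} \<rightarrow> carrier R \<Longrightarrow> u a \<in> Units R"
    "\<And>a. a \<in> {1..i} \<rightarrow> carrier R \<Longrightarrow> h a = f a \<oplus> a i \<otimes> u a"
  shows "MT_coord i h"
  using assms unfolding MT_coord_def by auto

lemma MT_coord_SucD:
  assumes "MT_coord i h" "i \<ge> 2"
  obtains f u where "poly_fun {1..i-1} f" "poly_fun {1..i-1} u"
    "\<And>a. a \<in> {1..i-1} \<rightarrow> carrier R \<Longrightarrow> u a \<in> Units R"
    "\<And>a. a \<in> {1..i} \<rightarrow> carrier R \<Longrightarrow> h a = f a \<oplus> a i \<otimes> u a"
proof -
  have "i \<noteq> 1" using assms(2) by simp
  then have "\<exists>f u. poly_fun {1..i-1} f \<and> poly_fun {1..i-1} u \<and>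
       (\<forall>a\<in>{1..i-1} \<rightarrow> carrier R. u a \<in> Units R) \<and>
       (\<forall>a\<in>{1..i} \<rightarrow> carrier R. h a = f a \<oplus> a i \<otimes> u a)"
    using assms(1) unfolding MT_coord_def by simp
  then show ?thesis by (elim exE conjE) (rule that; simp)
qed

lemma MT_coord_poly:
  assumes "MT_coord i h" "i \<ge> 1" shows "poly_fun {1..i} h"
proof (cases "i = 1")
  case True
  then show ?thesis using assms unfolding MT_coord_def by simp
next
  case False
  then have i: "i \<ge> 2" using assms by simp
  obtain f u where f: "poly_fun {1..i-1} f" and u: "poly_fun {1..i-1} u"
    and eq: "\<And>a. a \<in> {1..i} \<rightarrow> carrier R \<Longrightarrow> h a = f a \<oplus> a i \<otimes> u a"
    by (rule MT_coord_SucD[OF assms(1) i]) (rule that)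
  have "{1..i-1} \<subseteq> {1..i}" by auto
  then have "poly_fun {1..i} (\<lambda>a. f a \<oplus> a i \<otimes> u a)"
    using i by (intro poly_fun_add poly_fun_mult poly_fun_var poly_fun_mono[OF f] poly_fun_mono[OF u]) auto
  then show ?thesis by (rule poly_fun_cong) (simp add: eq)
qed

definition MT_maps :: "nat \<Rightarrow> ((nat \<Rightarrow> 'a) \<Rightarrow> nat \<Rightarrow> 'a) set"
  where "MT_maps n = {g. \<exists>h. (\<forall>i\<in>{1..n}. MT_coord i (h i)) \<and>
    g = (\<lambda>a\<in>points R n. \<lambda>i\<in>{1..n}. h i a)}"

definition MT_entry :: "nat \<Rightarrow> nat \<Rightarrow> (nat multiset \<Rightarrow> 'a) \<Rightarrow> bool"
  where "MT_entry n i F \<longleftrightarrow>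
    (if i = 1 then permutation_poly R F
     else \<exists>f \<in> carrier (mpoly_ring R {1..i-1}). \<exists>u \<in> carrier (mpoly_ring R {1..i-1}).
      unit_valued R (i-1) u \<and>
      F = f \<oplus>\<^bsub>mpoly_ring R {1..n}\<^esub> indexed_var i \<otimes>\<^bsub>mpoly_ring R {1..n}\<^esub> u)"

lemma carrier_MT:
  assumes "n \<ge> 1"
  shows "carrier (MT R n) = {F \<in> extensional {1..n}. \<forall>i\<in>{1..n}. MT_entry n i (F i)}"
proof -
  have "{1..n} = insert 1 {2..n}" using assms by auto
  then show ?thesis unfolding MT_def MT_entry_def by simp
qed

lemma MT_coord_value:
  assumes "i \<in> {1..n}" and entry: "MT_entry n i F"
  shows "MT_coord i (\<lambda>a. mpoly_value R a F)"
proof (cases "i = 1")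
  case True
  then show ?thesis using entry
    by (simp add: MT_entry_def MT_coord_def permutation_poly_def mpoly_ring_simps poly_fun_value)
next
  case False
  then obtain f u where fu: "f \<in> indexed_pset {1..i-1} (carrier R)" "u \<in> indexed_pset {1..i-1} (carrier R)"
    and unit: "unit_valued R (i-1) u"
    and "F = f \<oplus>\<^bsub>mpoly_ring R {1..n}\<^esub> indexed_var i \<otimes>\<^bsub>mpoly_ring R {1..n}\<^esub> u"
    using entry by (auto simp: MT_entry_def mpoly_ring_simps(1))
  then have F: "F = indexed_padd f (indexed_pmult u i)"
    by (simp add: mpoly_ring_simps(2) mpoly_ring_var_mult[OF pset_coeff_closed[OF fu(2)]])
  have i: "i \<ge> 2" using False assms(1) by simp
  show ?thesis
  proof (rule MT_coord_Suc[OF i poly_fun_value[OF fu(1)] poly_fun_value[OF fu(2)]])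
    fix a assume a: "a \<in> {1..i-1} \<rightarrow> carrier R"
    \<comment> \<open>\<open>unit_valued\<close> speaks of extensional points, while
      \<open>a\<close> may take any values outside \<open>{1..i-1}\<close>.\<close>
    have "mpoly_value R (restrict a {1..i-1}) u \<in> Units R"
      using unit a unfolding unit_valued_def points_def by (simp add: restrict_PiE_iff Pi_iff)
    then show "mpoly_value R a u \<in> Units R"
      using value_cong[OF fu(2) a, of "restrict a {1..i-1}"] by simp
  next
    fix a assume a: "a \<in> {1..i} \<rightarrow> carrier R"
    have mono: "f \<in> indexed_pset {1..i} (carrier R)" "u \<in> indexed_pset {1..i} (carrier R)"
      using fu pset_mono[of _ "{1..i-1}" "carrier R" "{1..i}"] by auto
    have ai: "a i \<in> carrier R" "i \<in> {1..i}" using a i by auto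
    have "mpoly_value R a F = mpoly_value R a f \<oplus> mpoly_value R a u \<otimes> a i"
      unfolding F value_padd[OF a mono(1) indexed_pset.indexed_pmult[OF mono(2) ai(2)]]
        value_pmult[OF a mono(2) ai(2)] ..
    then show "mpoly_value R a F = mpoly_value R a f \<oplus> a i \<otimes> mpoly_value R a u"
      using value_closed[OF a mono(2)] ai(1) by (simp add: m_comm)
  qed
qed

text \<open>A polynomial for \<open>h\<close> as a whole need not have the required shape. For
  \<open>i > 1\<close> polynomials are chosen for \<open>f\<close> and \<open>u\<close> separately
  and then combined.\<close>

lemma MT_coord_obtain_poly:
  assumes "i \<in> {1..n}" "MT_coord i h"
  shows "\<exists>F. MT_entry n i F \<and> (\<forall>a\<in>{1..i} \<rightarrow> carrier R. mpoly_value R a F = h a)"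
proof (cases "i = 1")
  case True
  then have h: "poly_fun {1} h" and bij: "bij_betw (\<lambda>r. h (\<lambda>_. r)) (carrier R) (carrier R)"
    using assms(2) by (auto simp: MT_coord_def)
  from h obtain F where F: "F \<in> indexed_pset {1} (carrier R)"
    and eq: "\<And>a. a \<in> {1} \<rightarrow> carrier R \<Longrightarrow> h a = mpoly_value R a F"
    unfolding poly_fun_def by metis
  have "bij_betw (\<lambda>r. mpoly_value R (\<lambda>_. r) F) (carrier R) (carrier R)"
    using bij by (subst bij_betw_cong[of _ _ "\<lambda>r. h (\<lambda>_. r)"]) (simp_all add: eq)
  then have "permutation_poly R F" using F by (simp add: permutation_poly_def mpoly_ring_simps)
  then show ?thesis using True eq by (intro exI[of _ F]) (simp add: MT_entry_def)
next
  case False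
  have i: "i \<ge> 2" using False assms(1) by simp
  obtain f u where f: "poly_fun {1..i-1} f" and u: "poly_fun {1..i-1} u"
    and unit: "\<And>a. a \<in> {1..i-1} \<rightarrow> carrier R \<Longrightarrow> u a \<in> Units R"
    and eq: "\<And>a. a \<in> {1..i} \<rightarrow> carrier R \<Longrightarrow> h a = f a \<oplus> a i \<otimes> u a"
    by (rule MT_coord_SucD[OF assms(2) i]) (rule that)
  from f obtain P where P: "P \<in> indexed_pset {1..i-1} (carrier R)"
    and Pf: "\<And>a. a \<in> {1..i-1} \<rightarrow> carrier R \<Longrightarrow> f a = mpoly_value R a P"
    unfolding poly_fun_def by metis
  from u obtain Q where Q: "Q \<in> indexed_pset {1..i-1} (carrier R)"
    and Qu: "\<And>a. a \<in> {1..i-1} \<rightarrow> carrier R \<Longrightarrow> u a = mpoly_value R a Q"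
    unfolding poly_fun_def by metis
  let ?F = "indexed_padd P (indexed_pmult Q i)"
  have F: "?F = P \<oplus>\<^bsub>mpoly_ring R {1..n}\<^esub> indexed_var i \<otimes>\<^bsub>mpoly_ring R {1..n}\<^esub> Q"
    by (simp add: mpoly_ring_simps(2) mpoly_ring_var_mult[OF pset_coeff_closed[OF Q]])
  have "unit_valued R (i-1) Q"
    unfolding unit_valued_def points_def using unit Qu by (auto simp: PiE_iff Pi_iff)
  moreover have "mpoly_value R a ?F = h a" if a: "a \<in> {1..i} \<rightarrow> carrier R" for a
  proof -
    have a': "a \<in> {1..i-1} \<rightarrow> carrier R" using a by auto
    have mono: "P \<in> indexed_pset {1..i} (carrier R)" "Q \<in> indexed_pset {1..i} (carrier R)"
      using P Q pset_mono[of _ "{1..i-1}" "carrier R" "{1..i}"] by auto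
    have ai: "a i \<in> carrier R" "i \<in> {1..i}" using a i by auto
    have "mpoly_value R a ?F = mpoly_value R a P \<oplus> mpoly_value R a Q \<otimes> a i"
      unfolding value_padd[OF a mono(1) indexed_pset.indexed_pmult[OF mono(2) ai(2)]]
        value_pmult[OF a mono(2) ai(2)] ..
    then show ?thesis
      using value_closed[OF a mono(2)] ai(1) by (simp add: m_comm eq[OF a] Pf[OF a'] Qu[OF a'])
  qed
  ultimately show ?thesis
    using False P Q F by (intro exI[of _ ?F]) (auto simp: MT_entry_def mpoly_ring_simps(1))
qed

lemma points_subset: "\<lbrakk>a \<in> points R n; i \<le> n\<rbrakk> \<Longrightarrow> a \<in> {1..i} \<rightarrow> carrier R"
  unfolding points_def by auto

lemma carrier_MT_perms:
  assumes n: "n \<ge> 1" shows "carrier (MT_perms R n) = MT_maps n"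
proof -
  have "induced_map R n ` carrier (MT R n) = MT_maps n"
  proof (intro equalityI subsetI)
    fix g assume "g \<in> induced_map R n ` carrier (MT R n)"
    then obtain F where F: "\<forall>i\<in>{1..n}. MT_entry n i (F i)" and g: "g = induced_map R n F"
      unfolding carrier_MT[OF n] by auto
    have "MT_coord i (\<lambda>a. mpoly_value R a (F i))" if "i \<in> {1..n}" for i
      using MT_coord_value[OF that] F that by blast
    then show "g \<in> MT_maps n"
      unfolding MT_maps_def g induced_map_def
      by (intro CollectI exI[of _ "\<lambda>i a. mpoly_value R a (F i)"]) auto
  next
    fix g assume "g \<in> MT_maps n"
    then obtain h where h: "\<And>i. i \<in> {1..n} \<Longrightarrow> MT_coord i (h i)"
      and g: "g = (\<lambda>a\<in>points R n. \<lambda>i\<in>{1..n}. h i a)"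
      unfolding MT_maps_def by blast
    have "\<forall>i\<in>{1..n}. \<exists>F. MT_entry n i F \<and> (\<forall>a\<in>{1..i} \<rightarrow> carrier R. mpoly_value R a F = h i a)"
      using MT_coord_obtain_poly h by blast
    then obtain F0 where F0: "\<And>i. i \<in> {1..n} \<Longrightarrow>
        MT_entry n i (F0 i) \<and> (\<forall>a\<in>{1..i} \<rightarrow> carrier R. mpoly_value R a (F0 i) = h i a)"
      using bchoice[of "{1..n}" "\<lambda>i F. MT_entry n i F \<and> (\<forall>a\<in>{1..i} \<rightarrow> carrier R. mpoly_value R a F = h i a)"]
      by blast
    define F where "F = restrict F0 {1..n}"
    have "F \<in> carrier (MT R n)"
      using F0 unfolding carrier_MT[OF n] F_def by simp
    moreover have "g = induced_map R n F"
      unfolding g induced_map_def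
    proof (rule restrict_ext, rule restrict_ext)
      fix a i assume a: "a \<in> points R n" and i: "i \<in> {1..n}"
      then have "a \<in> {1..i} \<rightarrow> carrier R" using points_subset by simp
      then show "h i a = mpoly_value R a (F i)" using F0[OF i] i by (simp add: F_def)
    qed
    ultimately show "g \<in> induced_map R n ` carrier (MT R n)" by blast
  qed
  then show ?thesis by (simp add: MT_perms_def)
qed

end

text \<open>In a finite group the inverse of \<open>x\<close> is its power with exponent
  \<open>order G - 1\<close>.\<close>

lemma (in group) subgroup_of_finite:
  assumes fin: "finite (carrier G)" and H: "H \<subseteq> carrier G" "\<one> \<in> H"
    and mult: "\<And>x y. \<lbrakk>x \<in> H; y \<in> H\<rbrakk> \<Longrightarrow> x \<otimes> y \<in> H"
  shows "subgroup H G"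
proof (rule subgroupI[OF H(1)])
  show "H \<noteq> {}" using H by blast
  fix x assume x: "x \<in> H"
  then have xc: "x \<in> carrier G" using H by blast
  have pow: "x [^] (k::nat) \<in> H" for k by (induction k) (use H x mult in auto)
  have "order G > 0" using fin order_gt_0_iff_finite by simp
  then have "x [^] (order G - 1) \<otimes> x = \<one>"
    using pow_order_eq_1[OF xc] xc by (metis Suc_diff_1 nat_pow_Suc)
  then have "inv x = x [^] (order G - 1)" using xc by (simp add: inv_equality)
  then show "inv x \<in> H" using pow by simp
qed (rule mult)

lemma (in group) commutator_eqI:
  assumes "x \<in> carrier G" "y \<in> carrier G" "z \<in> carrier G" "x \<otimes> y = z \<otimes> (y \<otimes> x)"
  shows "x \<otimes> y \<otimes> inv x \<otimes> inv y = z"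
proof -
  have "x \<otimes> y \<otimes> inv x \<otimes> inv y = z \<otimes> y \<otimes> (x \<otimes> inv x) \<otimes> inv y"
    using assms by (simp add: m_assoc del: r_inv)
  then show ?thesis using assms by (simp add: m_assoc)
qed

context cring begin

lemma affine_substitution:
  assumes "b \<in> carrier R" "c \<in> carrier R" "d \<in> carrier R" "e \<in> carrier R" "x \<in> carrier R"
  shows "b \<oplus> (d \<oplus> x \<otimes> e) \<otimes> c = (b \<oplus> d \<otimes> c) \<oplus> x \<otimes> (e \<otimes> c)"
  using assms by algebra

text \<open>In coordinate \<open>1\<close> two bijections are composed. For \<open>i > 1\<close>,
  replacing \<open>x_i\<close> by \<open>f' + x_i u'\<close> in \<open>f + x_i u\<close> gives the
  new factor \<open>u'\<close> times the substituted \<open>u\<close>, a product of units;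
  \<open>f\<close> and \<open>u\<close> only see earlier coordinates, which remain functions of the
  earlier variables.\<close>

lemma MT_coord_comp:
  assumes i: "i \<in> {1..n}" and h: "\<And>j. j \<in> {1..n} \<Longrightarrow> MT_coord j (h j)" and k: "MT_coord i k"
  shows "MT_coord i (\<lambda>a. k (\<lambda>j. h j a))"
proof -
  have hp: "poly_fun {1..j} (h j)" if "j \<in> {1..n}" for j
    using MT_coord_poly h that by simp
  have hp': "poly_fun {1..l} (h j)" if "j \<in> {1..l}" "l \<le> n" for j l
    by (rule poly_fun_mono[OF hp]) (use that in auto)
  have hcl: "(\<lambda>j. h j a) \<in> {1..l} \<rightarrow> carrier R" if "a \<in> {1..l} \<rightarrow> carrier R" "l \<le> n" for a l
    using poly_fun_closed[OF hp' that(1)] that(2) by auto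
  have subst: "poly_fun {1..l} (\<lambda>a. \<phi> (\<lambda>j. h j a))" if "poly_fun {1..l} \<phi>" "l \<le> n" for \<phi> l
    by (rule poly_fun_subst[OF that(1)]) (use hp' that(2) in auto)
  show ?thesis
  proof (cases "i = 1")
    case True
    have kp: "poly_fun {1} k" and kb: "bij_betw (\<lambda>r. k (\<lambda>_. r)) (carrier R) (carrier R)"
      using k True by (auto simp: MT_coord_def)
    have h1: "poly_fun {1} (h 1)" and hb: "bij_betw (\<lambda>r. h 1 (\<lambda>_. r)) (carrier R) (carrier R)"
      using h[of 1] i True by (auto simp: MT_coord_def)
    have "k (\<lambda>j. h j (\<lambda>_. r)) = k (\<lambda>_. h 1 (\<lambda>_. r))" if "r \<in> carrier R" for r
      by (rule poly_fun_dependency[OF kp]) (use poly_fun_closed[OF h1, of "\<lambda>_. r"] that in auto)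
    then have "bij_betw (\<lambda>r. k (\<lambda>j. h j (\<lambda>_. r))) (carrier R) (carrier R)"
      using bij_betw_trans[OF hb kb] by (subst bij_betw_cong) (auto simp: comp_def)
    moreover have "poly_fun {1} (\<lambda>a. k (\<lambda>j. h j a))"
      using subst[of 1 k] kp i True by simp
    ultimately show ?thesis using True by (simp add: MT_coord_def)
  next
    case False
    then have i2: "i \<ge> 2" using i by simp
    obtain f u where f: "poly_fun {1..i-1} f" and u: "poly_fun {1..i-1} u"
      and unit: "\<And>a. a \<in> {1..i-1} \<rightarrow> carrier R \<Longrightarrow> u a \<in> Units R"
      and eq: "\<And>a. a \<in> {1..i} \<rightarrow> carrier R \<Longrightarrow> k a = f a \<oplus> a i \<otimes> u a"
      by (rule MT_coord_SucD[OF k i2]) (rule that)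
    obtain f' u' where f': "poly_fun {1..i-1} f'" and u': "poly_fun {1..i-1} u'"
      and unit': "\<And>a. a \<in> {1..i-1} \<rightarrow> carrier R \<Longrightarrow> u' a \<in> Units R"
      and eq': "\<And>a. a \<in> {1..i} \<rightarrow> carrier R \<Longrightarrow> h i a = f' a \<oplus> a i \<otimes> u' a"
      by (rule MT_coord_SucD[OF h[OF i] i2]) (rule that)
    let ?H = "\<lambda>a j. h j a"
    have le: "i - 1 \<le> n" "i \<le> n" using i by auto
    show ?thesis
    proof (rule MT_coord_Suc[OF i2])
      show "poly_fun {1..i-1} (\<lambda>a. f (?H a) \<oplus> f' a \<otimes> u (?H a))"
        by (rule poly_fun_add[OF subst[OF f le(1)] poly_fun_mult[OF f' subst[OF u le(1)]]])
      show "poly_fun {1..i-1} (\<lambda>a. u' a \<otimes> u (?H a))"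
        by (rule poly_fun_mult[OF u' subst[OF u le(1)]])
      show "u' a \<otimes> u (?H a) \<in> Units R" if "a \<in> {1..i-1} \<rightarrow> carrier R" for a
        using unit[OF hcl[OF that le(1)]] unit'[OF that] by simp
      fix a assume a: "a \<in> {1..i} \<rightarrow> carrier R"
      then have a': "a \<in> {1..i-1} \<rightarrow> carrier R" and ai: "a i \<in> carrier R" using i by auto
      have cl: "f (?H a) \<in> carrier R" "u (?H a) \<in> carrier R" "f' a \<in> carrier R" "u' a \<in> carrier R"
        using poly_fun_closed[OF f hcl[OF a' le(1)]] poly_fun_closed[OF u hcl[OF a' le(1)]]
          poly_fun_closed[OF f' a'] poly_fun_closed[OF u' a'] by auto
      have "k (?H a) = f (?H a) \<oplus> (f' a \<oplus> a i \<otimes> u' a) \<otimes> u (?H a)"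
        using eq[OF hcl[OF a le(2)]] eq'[OF a] by simp
      also have "\<dots> = (f (?H a) \<oplus> f' a \<otimes> u (?H a)) \<oplus> a i \<otimes> (u' a \<otimes> u (?H a))"
        using affine_substitution cl ai by simp
      finally show "k (?H a) = (f (?H a) \<oplus> f' a \<otimes> u (?H a)) \<oplus> a i \<otimes> (u' a \<otimes> u (?H a))" .
    qed
  qed
qed

lemma MT_coord_id: "i \<ge> 1 \<Longrightarrow> MT_coord i (\<lambda>a. a i)"
proof (cases "i = 1")
  case True
  then show ?thesis using poly_fun_var[of "1::nat" "{1}"]
    by (simp add: MT_coord_def bij_betw_def)
next
  case False
  assume "i \<ge> 1"
  then show ?thesis
    using False poly_fun_const[OF zero_closed] poly_fun_const[OF one_closed]
    by (intro MT_coord_Suc[of i "\<lambda>_. \<zero>" "\<lambda>_. \<one>"]) (auto simp: Pi_iff)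
qed

lemma MT_mapsE:
  assumes "g \<in> MT_maps n"
  obtains h where "\<And>i. i \<in> {1..n} \<Longrightarrow> MT_coord i (h i)" "g = (\<lambda>a\<in>points R n. \<lambda>i\<in>{1..n}. h i a)"
  using assms unfolding MT_maps_def by blast

lemma MT_maps_into:
  assumes "g \<in> MT_maps n" "a \<in> points R n" shows "g a \<in> points R n"
proof -
  obtain h where h: "\<And>i. i \<in> {1..n} \<Longrightarrow> MT_coord i (h i)"
    and g: "g = (\<lambda>a\<in>points R n. \<lambda>i\<in>{1..n}. h i a)"
    by (rule MT_mapsE[OF assms(1)]) (rule that)
  have "h i a \<in> carrier R" if "i \<in> {1..n}" for i
    using poly_fun_closed[OF MT_coord_poly[OF h[OF that]] points_subset[OF assms(2)]] that by simp
  then show ?thesis unfolding g using assms(2) by (simp add: points_def)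
qed

lemma MT_maps_one: "(\<lambda>a\<in>points R n. a) \<in> MT_maps n"
proof -
  have "(\<lambda>a\<in>points R n. a) = (\<lambda>a\<in>points R n. \<lambda>i\<in>{1..n}. a i)"
    by (rule restrict_ext) (auto simp: points_def PiE_restrict)
  then show ?thesis unfolding MT_maps_def
    by (intro CollectI exI[of _ "\<lambda>i a. a i"]) (simp add: MT_coord_id)
qed

lemma MT_maps_compose:
  assumes "g \<in> MT_maps n" "g' \<in> MT_maps n" shows "compose (points R n) g g' \<in> MT_maps n"
proof -
  obtain k where k: "\<And>i. i \<in> {1..n} \<Longrightarrow> MT_coord i (k i)"
    and g: "g = (\<lambda>a\<in>points R n. \<lambda>i\<in>{1..n}. k i a)"
    by (rule MT_mapsE[OF assms(1)]) (rule that)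
  obtain h where h: "\<And>i. i \<in> {1..n} \<Longrightarrow> MT_coord i (h i)"
    and g': "g' = (\<lambda>a\<in>points R n. \<lambda>i\<in>{1..n}. h i a)"
    by (rule MT_mapsE[OF assms(2)]) (rule that)
  have "compose (points R n) g g' = (\<lambda>a\<in>points R n. \<lambda>i\<in>{1..n}. k i (\<lambda>j. h j a))"
    unfolding compose_def
  proof (rule restrict_ext)
    fix a assume a: "a \<in> points R n"
    have b: "g' a \<in> points R n" using MT_maps_into[OF assms(2) a] .
    have "k i (g' a) = k i (\<lambda>j. h j a)" if i: "i \<in> {1..n}" for i
    proof (rule poly_fun_dependency[OF MT_coord_poly[OF k[OF i]]])
      show "g' a \<in> {1..i} \<rightarrow> carrier R" using points_subset[OF b] i by simp
      show "g' a j = h j a" if "j \<in> {1..i}" for j using a i that by (simp add: g')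
    qed (use i in simp)
    then show "g (g' a) = (\<lambda>i\<in>{1..n}. k i (\<lambda>j. h j a))"
      unfolding g using b by (auto intro!: restrict_ext)
  qed
  then show ?thesis unfolding MT_maps_def
    by (intro CollectI exI[of _ "\<lambda>i a. k i (\<lambda>j. h j a)"] conjI ballI MT_coord_comp[OF _ h k])
qed

text \<open>The coordinates are recovered in order: the first by bijectivity, and each later one
  because its factor \<open>u\<close> is a unit and \<open>f\<close>, \<open>u\<close> are already
  determined.\<close>

lemma MT_maps_inj:
  assumes "g \<in> MT_maps n" shows "inj_on g (points R n)"
proof (rule inj_onI)
  fix a b assume a: "a \<in> points R n" and b: "b \<in> points R n" and eq: "g a = g b"
  obtain h where h: "\<And>i. i \<in> {1..n} \<Longrightarrow> MT_coord i (h i)"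
    and g: "g = (\<lambda>a\<in>points R n. \<lambda>i\<in>{1..n}. h i a)"
    by (rule MT_mapsE[OF assms(1)]) (rule that)
  have heq: "h i a = h i b" if "i \<in> {1..n}" for i
    using fun_cong[OF eq, of i] a b that by (simp add: g)
  have "i \<in> {1..n} \<Longrightarrow> a i = b i" for i
  proof (induction i rule: less_induct)
    case (less i)
    have ai: "a i \<in> carrier R" "b i \<in> carrier R" using a b less.prems by (auto simp: points_def)
    show ?case
    proof (cases "i = 1")
      case True
      have hp: "poly_fun {1} (h 1)" and hb: "bij_betw (\<lambda>r. h 1 (\<lambda>_. r)) (carrier R) (carrier R)"
        using h[OF less.prems] True by (auto simp: MT_coord_def)
      have "h 1 a = h 1 (\<lambda>_. a 1)" "h 1 b = h 1 (\<lambda>_. b 1)"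
        by (rule poly_fun_dependency[OF hp]; use ai True in simp)+
      then have "h 1 (\<lambda>_. a 1) = h 1 (\<lambda>_. b 1)" using heq less.prems True by simp
      then show ?thesis using inj_onD[OF bij_betw_imp_inj_on[OF hb]] ai True by simp
    next
      case False
      then have i2: "i \<ge> 2" using less.prems by simp
      obtain f u where f: "poly_fun {1..i-1} f" and u: "poly_fun {1..i-1} u"
        and unit: "\<And>a. a \<in> {1..i-1} \<rightarrow> carrier R \<Longrightarrow> u a \<in> Units R"
        and eq: "\<And>a. a \<in> {1..i} \<rightarrow> carrier R \<Longrightarrow> h i a = f a \<oplus> a i \<otimes> u a"
        by (rule MT_coord_SucD[OF h[OF less.prems] i2]) (rule that)
      have cl: "a \<in> {1..i} \<rightarrow> carrier R" "b \<in> {1..i} \<rightarrow> carrier R" "a \<in> {1..i-1} \<rightarrow> carrier R"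
        using points_subset[OF a, of i] points_subset[OF b, of i] points_subset[OF a, of "i-1"]
          less.prems by auto
      have ab: "a j = b j" if "j \<in> {1..i-1}" for j using less.IH[of j] less.prems that by auto
      have fu: "f a = f b" "u a = u b"
        using poly_fun_dependency[OF f cl(3) ab] poly_fun_dependency[OF u cl(3) ab] by auto
      have fc: "f a \<in> carrier R" using poly_fun_closed[OF f cl(3)] .
      have uc: "u a \<in> Units R" using unit[OF cl(3)] .
      have "f a \<oplus> a i \<otimes> u a = f a \<oplus> b i \<otimes> u a"
        using heq[OF less.prems] eq[OF cl(1)] eq[OF cl(2)] fu by simp
      then have "a i \<otimes> u a = b i \<otimes> u a" using fc ai Units_closed[OF uc] by simp
      then show ?thesis
        using uc ai by (metis Units_closed Units_l_cancel m_comm)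
    qed
  qed
  then show "a = b" using a b unfolding points_def by (intro PiE_ext) auto
qed

end

section \<open>The group of induced permutations\<close>

locale MT_setting = finite_local_ring +
  fixes n :: nat
  assumes n_ge_1: "n \<ge> 1"
begin

abbreviation G :: "((nat \<Rightarrow> 'a) \<Rightarrow> nat \<Rightarrow> 'a) monoid"
  where "G \<equiv> MT_perms R n"

lemma carrier_G: "carrier G = MT_maps n"
  by (rule carrier_MT_perms[OF n_ge_1])

lemma G_eq: "G = (BijGroup (points R n))\<lparr>carrier := MT_maps n\<rparr>"
  using carrier_G by (simp add: MT_perms_def)

lemma finite_points: "finite (points R n)"
  unfolding points_def using finite_carrier by (simp add: finite_PiE)

lemma MT_maps_Bij: "MT_maps n \<subseteq> Bij (points R n)"
proof
  fix g assume g: "g \<in> MT_maps n"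
  have "g ` points R n = points R n"
    using MT_maps_into[OF g] MT_maps_inj[OF g]
    by (intro endo_inj_surj[OF finite_points]) auto
  then show "g \<in> Bij (points R n)"
    using g MT_maps_inj[OF g] by (auto simp: Bij_def bij_betw_def MT_maps_def)
qed

lemma subgroup_MT_maps: "subgroup (MT_maps n) (BijGroup (points R n))"
proof (rule group.subgroup_of_finite[OF group_BijGroup])
  have "Bij (points R n) \<subseteq> points R n \<rightarrow>\<^sub>E points R n"
    using Bij_imp_funcset Bij_imp_extensional by (auto simp: PiE_def)
  then show "finite (carrier (BijGroup (points R n)))"
    using finite_subset[OF _ finite_PiE[OF finite_points finite_points]] by (simp add: BijGroup_def)
  show "MT_maps n \<subseteq> carrier (BijGroup (points R n))" using MT_maps_Bij by (simp add: BijGroup_def)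
  show "\<one>\<^bsub>BijGroup (points R n)\<^esub> \<in> MT_maps n" using MT_maps_one by (simp add: BijGroup_def)
  show "x \<otimes>\<^bsub>BijGroup (points R n)\<^esub> y \<in> MT_maps n" if "x \<in> MT_maps n" "y \<in> MT_maps n" for x y
    using MT_maps_compose[OF that] MT_maps_Bij that by (simp add: BijGroup_def subset_iff)
qed

lemma group_G: "group G"
  unfolding G_eq by (rule group.subgroup_imp_group[OF group_BijGroup subgroup_MT_maps])

lemma G_mult:
  assumes "g \<in> carrier G" "h \<in> carrier G" shows "g \<otimes>\<^bsub>G\<^esub> h = compose (points R n) g h"
  using assms MT_maps_Bij by (auto simp: G_eq BijGroup_def subset_iff)

lemma G_one: "\<one>\<^bsub>G\<^esub> = (\<lambda>a\<in>points R n. a)"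
  by (simp add: G_eq BijGroup_def)

lemma G_coord_poly:
  assumes "g \<in> carrier G" "i \<in> {1..n}"
  obtains \<phi> where "poly_fun {1..i} \<phi>" "\<And>a. a \<in> points R n \<Longrightarrow> g a i = \<phi> a"
proof -
  obtain h where h: "\<And>i. i \<in> {1..n} \<Longrightarrow> MT_coord i (h i)"
    and g: "g = (\<lambda>a\<in>points R n. \<lambda>i\<in>{1..n}. h i a)"
    using assms(1) unfolding carrier_G by (rule MT_mapsE) (rule that)
  show ?thesis
    by (rule that[OF MT_coord_poly[OF h[OF assms(2)]]]) (use assms(2) in \<open>auto simp: g\<close>)
qed

end

lemma (in cring) affine_commutator:
  assumes "u \<in> carrier R" "c \<in> carrier R" "x \<in> carrier R"
  shows "u \<otimes> x \<oplus> c = u \<otimes> (x \<oplus> c) \<oplus> (\<one> \<ominus> u) \<otimes> c"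
  using assms by algebra

lemma points_coord: "\<lbrakk>a \<in> points R n; i \<in> {1..n}\<rbrakk> \<Longrightarrow> a i \<in> carrier R"
  unfolding points_def by (rule PiE_mem)

context MT_setting begin

lemma exists_digit_group: "\<exists>t N. digit_group G (points R n) t N q"
proof -
  obtain N t where t: "digit_system (carrier R) N t"
    using exists_digit_system[OF oneideal] by blast
  have range: "t k x \<in> {1..q}" if "k < N" "x \<in> carrier R" for k x
    using t that unfolding digit_system_def by simp
  have sep: "x = y" if "x \<in> carrier R" "y \<in> carrier R" "\<forall>k<N. t k x = t k y" for x y
    using t that minus_closed[OF that(1,2)] unfolding digit_system_def by simp
  have cong: "\<exists>A. ideal A R \<and> (\<forall>x\<in>carrier R. \<forall>y\<in>carrier R. (\<forall>j<k. t j x = t j y) \<longleftrightarrow> x \<ominus> y \<in> A)"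
    if "k \<le> N" for k
  proof -
    have "\<exists>A. ideal A R \<and> (\<forall>x\<in>carrier R. \<forall>y\<in>carrier R.
        x \<ominus> y \<in> carrier R \<and> (\<forall>j<k. t j x = t j y) \<longleftrightarrow> x \<ominus> y \<in> A)"
      using t that unfolding digit_system_def by simp
    then show ?thesis by simp
  qed
  define s where "s k a = t (k mod N) (a (Suc (k div N)))" for k and a :: "nat \<Rightarrow> 'a"
  have s_at: "s ((i - 1) * N + j) a = t j (a i)" if "i \<ge> 1" "j < N" for i j a
    using that by (simp add: s_def)
  have index: "(i - 1) * N + j < i * N" if "i \<ge> 1" "j < N" for i j
    using that by (cases i) simp_all
  have "digit_group G (points R n) s (n * N) q"
  proof (intro digit_group.intro digit_group_axioms.intro group_G)
    show "carrier G \<subseteq> Bij (points R n)" using MT_maps_Bij carrier_G by simp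
    show "(g \<otimes>\<^bsub>G\<^esub> h) a = g (h a)" if "g \<in> carrier G" "h \<in> carrier G" "a \<in> points R n" for g h a
      using G_mult[OF that(1,2)] that(3) by (simp add: compose_eq)
    show "\<one>\<^bsub>G\<^esub> a = a" if "a \<in> points R n" for a using that by (simp add: G_one)
    show "s k a \<in> {1..q}" if k: "k < n * N" and a: "a \<in> points R n" for k a
    proof -
      have "N > 0" using k by (cases N) auto
      moreover have "Suc (k div N) \<in> {1..n}" using less_mult_imp_div_less[OF k] by simp
      then have "a (Suc (k div N)) \<in> carrier R" using a by (auto simp: points_def)
      ultimately show ?thesis unfolding s_def by (intro range) auto
    qed
  next
    fix a b assume a: "a \<in> points R n" and b: "b \<in> points R n"
      and eq: "\<And>k. k < n * N \<Longrightarrow> s k a = s k b"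
    have "a i = b i" if i: "i \<in> {1..n}" for i
    proof (rule sep)
      show "a i \<in> carrier R" "b i \<in> carrier R" using a b i by (auto simp: points_def)
      show "\<forall>j<N. t j (a i) = t j (b i)"
      proof (intro allI impI)
        fix j assume j: "j < N"
        have "i * N \<le> n * N" using i by simp
        moreover have "(i - 1) * N + j < i * N" using index i j by simp
        ultimately have "(i - 1) * N + j < n * N" by linarith
        from eq[OF this] show "t j (a i) = t j (b i)" using s_at[of i j] i j by simp
      qed
    qed
    then show "a = b" using a b unfolding points_def by (intro PiE_ext) auto
  next
    fix g a b k assume g: "g \<in> carrier G" and a: "a \<in> points R n" and b: "b \<in> points R n"
      and k: "k < n * N" and eq: "\<And>j. j \<le> k \<Longrightarrow> s j a = s j b"
    define i m where "i = Suc (k div N)" and "m = k mod N"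
    have N: "N > 0" using k by (cases N) auto
    have i: "i \<in> {1..n}" using less_mult_imp_div_less[OF k] by (simp add: i_def)
    have m: "m < N" using N by (simp add: m_def)
    have k_eq: "k = (i - 1) * N + m" by (simp add: i_def m_def)
    have cl: "a j \<in> carrier R" "b j \<in> carrier R" if "j \<in> {1..n}" for j
      using a b that by (auto simp: points_def)
    \<comment> \<open>Agreement of all digits up to position \<open>k\<close> includes every digit
      of every earlier coordinate.\<close>
    have before: "a j = b j" if j: "j \<in> {1..<i}" for j
    proof (rule sep)
      show "a j \<in> carrier R" "b j \<in> carrier R" using cl j i by auto
      show "\<forall>l<N. t l (a j) = t l (b j)"
      proof (intro allI impI)
        fix l assume l: "l < N"
        have "j * N \<le> (i - 1) * N" using j by (intro mult_le_mono1) auto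
        moreover have "(j - 1) * N + l < j * N" using index j l by simp
        ultimately have "(j - 1) * N + l \<le> k" using k_eq by linarith
        from eq[OF this] show "t l (a j) = t l (b j)" using s_at[of j l] j l by simp
      qed
    qed
    obtain A where A: "ideal A R"
      \<comment> \<open>\<open>Suc m\<close> digits are compared, because the digit \<open>m\<close>
        itself belongs to both the assumption and the conclusion of triangularity.\<close>
      and AD: "\<forall>x\<in>carrier R. \<forall>y\<in>carrier R. (\<forall>j<Suc m. t j x = t j y) \<longleftrightarrow> x \<ominus> y \<in> A"
      using cong[of "Suc m"] m by auto
    interpret A: ideal A R by (rule A)
    have "t l (a i) = t l (b i)" if "l < Suc m" for l
    proof -
      have "(i - 1) * N + l \<le> k" using that k_eq by simp
      from eq[OF this] show ?thesis using s_at[of i l] i m that by simp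
    qed
    then have "a i \<ominus> b i \<in> A" using AD cl[OF i] by blast
    moreover have "a j \<ominus> b j \<in> A" if "j \<in> {1..<i}" for j
      using before[OF that] cl[of j] that i by (simp add: a_minus_def r_neg)
    \<comment> \<open>Earlier coordinates differ by zero and coordinate \<open>i\<close> by an
      element of \<open>A\<close>, so one ideal controls all variables of the polynomial for
      coordinate \<open>i\<close>.\<close>
    ultimately have diff: "a j \<ominus> b j \<in> A" if "j \<in> {1..i}" for j
      using that by (cases "j = i") auto
    obtain \<phi> where \<phi>: "poly_fun {1..i} \<phi>" and g\<phi>: "\<And>a. a \<in> points R n \<Longrightarrow> g a i = \<phi> a"
      by (rule G_coord_poly[OF g i]) (rule that)
    have "a \<in> {1..i} \<rightarrow> carrier R" "b \<in> {1..i} \<rightarrow> carrier R"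
      using points_subset a b i by auto
    then have "g a i \<ominus> g b i \<in> A"
      using poly_fun_ideal_cong[OF A \<phi> _ _ diff] g\<phi>[OF a] g\<phi>[OF b] by simp
    moreover have "g a i \<in> carrier R" "g b i \<in> carrier R"
      using points_coord[OF MT_maps_into[of g n a] i] points_coord[OF MT_maps_into[of g n b] i]
        g a b carrier_G by simp_all
    ultimately show "s k (g a) = s k (g b)"
      using AD unfolding s_def i_def[symmetric] m_def[symmetric] by blast
  qed
  then show ?thesis by blast
qed

lemma solvable_G: "q \<le> 4 \<Longrightarrow> solvable G"
  using exists_digit_group digit_group.solvable_digit_group by blast

lemma nilpotent_G: "q = 2 \<Longrightarrow> nilpotent_group G"
  using exists_digit_group digit_group.nilpotent_digit_group by metis

section \<open>Permutations that change only the first coordinate\<close>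

definition first_map :: "('a \<Rightarrow> 'a) \<Rightarrow> (nat \<Rightarrow> 'a) \<Rightarrow> nat \<Rightarrow> 'a"
  where "first_map \<phi> = (\<lambda>a\<in>points R n. a(1 := \<phi> (a 1)))"

text \<open>Test points: the first coordinate of \<open>first_map \<phi>\<close> at such a point is
  \<open>\<phi> r\<close>, so \<open>first_map \<phi>\<close> determines \<open>\<phi>\<close> on
  the ring.\<close>

definition diagonal_point :: "'a \<Rightarrow> nat \<Rightarrow> 'a"
  where "diagonal_point r = (\<lambda>i\<in>{1..n}. r)"

lemma diagonal_point: "r \<in> carrier R \<Longrightarrow> diagonal_point r \<in> points R n"
  by (auto simp: diagonal_point_def points_def)

lemma first_map_in_G:
  assumes "poly_fun {1} (\<lambda>a. \<phi> (a (1::nat)))" "bij_betw \<phi> (carrier R) (carrier R)"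
  shows "first_map \<phi> \<in> carrier G"
proof -
  define h where "h i = (if i = 1 then (\<lambda>a. \<phi> (a 1)) else (\<lambda>a. a i))" for i :: nat
  have "MT_coord i (h i)" if "i \<in> {1..n}" for i
  proof (cases "i = 1")
    case True
    then show ?thesis using assms by (simp add: MT_coord_def h_def)
  next
    case False
    then show ?thesis using MT_coord_id[of i] that by (simp add: h_def)
  qed
  moreover have "first_map \<phi> = (\<lambda>a\<in>points R n. \<lambda>i\<in>{1..n}. h i a)"
    unfolding first_map_def
  proof (rule restrict_ext)
    fix a assume "a \<in> points R n"
    then have "a i = undefined" if "i \<notin> {1..n}" for i
      using PiE_arb[of a "{1..n}" "\<lambda>_. carrier R" i] that by (simp add: points_def)
    then show "a(1 := \<phi> (a 1)) = (\<lambda>i\<in>{1..n}. h i a)"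
      using n_ge_1 by (auto simp: h_def restrict_def)
  qed
  ultimately show ?thesis unfolding carrier_G MT_maps_def
    by (intro CollectI exI[of _ h] conjI ballI)
qed

lemma first_map_mult:
  assumes "first_map \<phi> \<in> carrier G" "first_map \<psi> \<in> carrier G"
  shows "first_map \<phi> \<otimes>\<^bsub>G\<^esub> first_map \<psi> = first_map (\<lambda>x. \<phi> (\<psi> x))"
  unfolding G_mult[OF assms] compose_def first_map_def[of "\<lambda>x. \<phi> (\<psi> x)"]
proof (rule restrict_ext)
  fix a assume a: "a \<in> points R n"
  then have "a(1 := \<psi> (a 1)) \<in> points R n"
    using MT_maps_into[of "first_map \<psi>" n a] assms(2) carrier_G by (simp add: first_map_def)
  then show "first_map \<phi> (first_map \<psi> a) = a(1 := \<phi> (\<psi> (a 1)))"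
    using a by (simp add: first_map_def)
qed

lemma first_map_diagonal: "r \<in> carrier R \<Longrightarrow> first_map \<phi> (diagonal_point r) 1 = \<phi> r"
  using diagonal_point n_ge_1 by (simp add: first_map_def diagonal_point_def)

lemma first_map_eqD: "\<lbrakk>first_map \<phi> = first_map \<psi>; r \<in> carrier R\<rbrakk> \<Longrightarrow> \<phi> r = \<psi> r"
  using first_map_diagonal by metis

lemma first_map_cong: "(\<And>r. r \<in> carrier R \<Longrightarrow> \<phi> r = \<psi> r) \<Longrightarrow> first_map \<phi> = first_map \<psi>"
  unfolding first_map_def
proof (rule restrict_ext)
  fix a assume eq: "\<And>r. r \<in> carrier R \<Longrightarrow> \<phi> r = \<psi> r" and a: "a \<in> points R n"
  have "a 1 \<in> carrier R" using a n_ge_1 by (auto simp: points_def)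
  then show "a(1 := \<phi> (a 1)) = a(1 := \<psi> (a 1))" by (simp add: eq)
qed

lemma affine_in_G:
  assumes "u \<in> Units R" "b \<in> carrier R" shows "first_map (\<lambda>x. u \<otimes> x \<oplus> b) \<in> carrier G"
proof (rule first_map_in_G)
  show "poly_fun {1} (\<lambda>a. u \<otimes> a (1::nat) \<oplus> b)"
    by (intro poly_fun_add poly_fun_mult poly_fun_const poly_fun_var) (use assms in auto)
  have "inj_on (\<lambda>x. u \<otimes> x \<oplus> b) (carrier R)"
  proof (rule inj_onI)
    fix x y assume xy: "x \<in> carrier R" "y \<in> carrier R" and "u \<otimes> x \<oplus> b = u \<otimes> y \<oplus> b"
    then have "u \<otimes> x = u \<otimes> y" using assms Units_closed[OF assms(1)] by simp
    then show "x = y" using Units_l_cancel[OF assms(1) xy] by simp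
  qed
  moreover have "(\<lambda>x. u \<otimes> x \<oplus> b) ` carrier R \<subseteq> carrier R" using assms by auto
  ultimately show "bij_betw (\<lambda>x. u \<otimes> x \<oplus> b) (carrier R) (carrier R)"
    using endo_inj_surj[OF finite_carrier] by (simp add: bij_betw_def)
qed

lemma translation_in_G:
  assumes "b \<in> carrier R" shows "first_map (\<lambda>x. x \<oplus> b) \<in> carrier G"
proof -
  have "first_map (\<lambda>x. \<one> \<otimes> x \<oplus> b) = first_map (\<lambda>x. x \<oplus> b)"
    by (rule first_map_cong) (simp add: assms)
  then show ?thesis using affine_in_G[OF Units_one_closed assms] by simp
qed

lemma scaling_in_G:
  assumes "u \<in> Units R" shows "first_map (\<lambda>x. u \<otimes> x) \<in> carrier G"
proof -
  have "first_map (\<lambda>x. u \<otimes> x \<oplus> \<zero>) = first_map (\<lambda>x. u \<otimes> x)"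
    by (rule first_map_cong) (simp add: assms Units_closed)
  then show ?thesis using affine_in_G[OF assms zero_closed] by simp
qed

lemma translation_in_lower_central:
  assumes u: "u \<in> Units R" and u1: "\<one> \<ominus> u \<in> Units R"
  shows "b \<in> carrier R \<Longrightarrow> first_map (\<lambda>x. x \<oplus> b) \<in> lower_central G k"
proof (induction k arbitrary: b)
  case 0
  then show ?case using translation_in_G by simp
next
  case (Suc k)
  interpret Gp: group G by (rule group_G)
  \<comment> \<open>The commutator of the translation by \<open>c\<close> with the scaling by
    \<open>u\<close> is the translation by \<open>(1 - u) c\<close>, and \<open>c\<close> is chosen
    to make this \<open>b\<close>.\<close>
  define c where "c = inv (\<one> \<ominus> u) \<otimes> b"
  have c: "c \<in> carrier R" and uc: "u \<in> carrier R" using u u1 Suc.prems by (auto simp: c_def)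
  have "(\<one> \<ominus> u) \<otimes> c = b"
    unfolding c_def using u1 Suc.prems m_assoc[of "\<one> \<ominus> u" "inv (\<one> \<ominus> u)" b]
      Units_closed[OF u1] by simp
  then have bc: "u \<otimes> x \<oplus> c = u \<otimes> (x \<oplus> c) \<oplus> b" if "x \<in> carrier R" for x
    using affine_commutator[OF uc c that] by simp
  let ?x = "first_map (\<lambda>x. x \<oplus> c)" and ?y = "first_map (\<lambda>x. u \<otimes> x)" and ?z = "first_map (\<lambda>x. x \<oplus> b)"
  have xyz: "?x \<in> carrier G" "?y \<in> carrier G" "?z \<in> carrier G"
    using translation_in_G scaling_in_G c u Suc.prems by auto
  have "?x \<otimes>\<^bsub>G\<^esub> ?y = ?z \<otimes>\<^bsub>G\<^esub> (?y \<otimes>\<^bsub>G\<^esub> ?x)"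
  proof -
    have yx: "?y \<otimes>\<^bsub>G\<^esub> ?x = first_map (\<lambda>x. u \<otimes> (x \<oplus> c))"
      by (rule first_map_mult[OF xyz(2,1)])
    have "?z \<otimes>\<^bsub>G\<^esub> (?y \<otimes>\<^bsub>G\<^esub> ?x) = first_map (\<lambda>x. u \<otimes> (x \<oplus> c) \<oplus> b)"
      using first_map_mult[OF xyz(3), of "\<lambda>x. u \<otimes> (x \<oplus> c)"] Gp.m_closed[OF xyz(2,1)]
      unfolding yx by blast
    also have "\<dots> = first_map (\<lambda>x. u \<otimes> x \<oplus> c)"
      by (rule first_map_cong) (rule bc[symmetric])
    also have "\<dots> = ?x \<otimes>\<^bsub>G\<^esub> ?y"
      by (rule first_map_mult[OF xyz(1,2), symmetric])
    finally show ?thesis by simp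
  qed
  then have "?x \<otimes>\<^bsub>G\<^esub> ?y \<otimes>\<^bsub>G\<^esub> inv\<^bsub>G\<^esub> ?x \<otimes>\<^bsub>G\<^esub> inv\<^bsub>G\<^esub> ?y = ?z"
    by (rule Gp.commutator_eqI[OF xyz])
  then show ?case unfolding lower_central.simps
    by (intro generate.incl UN_I[OF Suc.IH[OF c]] UN_I[OF xyz(2)]) simp
qed

lemma not_nilpotent_G: assumes "q \<ge> 3" shows "\<not> nilpotent_group G"
proof
  assume "nilpotent_group G"
  then obtain k where k: "lower_central G k = {\<one>\<^bsub>G\<^esub>}" by (auto simp: nilpotent_group_def)
  \<comment> \<open>For \<open>q \<ge> 3\<close> there is a residue class other than those of
    \<open>0\<close> and \<open>1\<close>. For its representative \<open>u\<close>, neither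
    \<open>u\<close> nor \<open>1 - u\<close> lies in \<open>M\<close>.\<close>
  have "card {residue \<zero>, residue \<one>} < card {1..q}"
    using assms card_insert_le_m1[of 2 "{residue \<one>}" "residue \<zero>"] by simp
  then have "\<not> {1..q} \<subseteq> {residue \<zero>, residue \<one>}"
    using card_mono[of "{residue \<zero>, residue \<one>}" "{1..q}"] by auto
  then obtain v where v: "v \<in> {1..q}" "v \<noteq> residue \<zero>" "v \<noteq> residue \<one>" by blast
  have u: "rep v \<in> carrier R" "residue (rep v) = v" using rep[OF v(1)] by auto
  have "rep v \<notin> M" using residue_eq_iff[OF u(1) zero_closed] u v by (simp add: a_minus_def)
  moreover have "\<one> \<ominus> rep v \<notin> M" using residue_eq_iff[OF one_closed u(1)] u v by auto
  ultimately have "rep v \<in> Units R" "\<one> \<ominus> rep v \<in> Units R" using Units_iff u by simp_all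
  then have "first_map (\<lambda>x. x \<oplus> \<one>) = \<one>\<^bsub>G\<^esub>"
    using translation_in_lower_central[of "rep v" \<one> k] k by simp
  moreover have "\<one>\<^bsub>G\<^esub> = first_map (\<lambda>x. x)"
    unfolding G_one first_map_def by (rule restrict_ext) simp
  ultimately have "\<zero> \<oplus> \<one> = \<zero>" using first_map_eqD[of "\<lambda>x. x \<oplus> \<one>" "\<lambda>x. x" \<zero>] by simp
  then show False using one_notin_M by simp
qed

end

section \<open>Solvability, nilpotency and commutativity\<close>

context cring begin

lemma translate_diff:
  assumes "x \<in> carrier R" "r \<in> carrier R" "s \<in> carrier R"
  shows "x \<oplus> (s \<ominus> r) \<ominus> s = x \<ominus> r"
  using assms by algebra

lemma translate_twice:
  assumes "x \<in> carrier R" "r \<in> carrier R" "s \<in> carrier R" "t \<in> carrier R"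
  shows "x \<oplus> (s \<ominus> r) \<oplus> (t \<ominus> s) = x \<oplus> (t \<ominus> r)"
  using assms by algebra

end

context MT_setting begin

text \<open>The permutation \<open>p\<close> of the residue classes, realised by translating each class as a whole.\<close>

definition class_shift :: "(nat \<Rightarrow> nat) \<Rightarrow> 'a \<Rightarrow> 'a"
  where "class_shift p x = x \<oplus> (rep (p (residue x)) \<ominus> rep (residue x))"

lemma class_shift_closed:
  assumes "p permutes {1..q}" "x \<in> carrier R"
  shows "class_shift p x \<in> carrier R" "residue (class_shift p x) = p (residue x)"
proof -
  let ?v = "residue x"
  have v: "?v \<in> {1..q}" "p ?v \<in> {1..q}"
    using residue_range[OF assms(2)] permutes_in_image[OF assms(1), of ?v] by auto
  note cl = rep(1)[OF v(1)] rep(1)[OF v(2)]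
  then show cs: "class_shift p x \<in> carrier R" using assms(2) by (simp add: class_shift_def)
  have "class_shift p x \<ominus> rep (p ?v) = x \<ominus> rep ?v"
    unfolding class_shift_def using translate_diff cl assms(2) by simp
  moreover have "x \<ominus> rep ?v \<in> M"
    using residue_eq_iff[OF assms(2) cl(1)] rep(2)[OF v(1)] by simp
  ultimately have "residue (class_shift p x) = residue (rep (p ?v))"
    using residue_eq_iff[OF cs cl(2)] by simp
  then show "residue (class_shift p x) = p ?v" using rep(2)[OF v(2)] by simp
qed

text \<open>The translations telescope: class \<open>v\<close> moves by
  \<open>rep (p' v) - rep v\<close> and then by \<open>rep (p (p' v)) - rep (p' v)\<close>. Fixing
  one representative per class thus makes the embedding multiplicative exactly, not only modulo
  \<open>M\<close>.\<close>

lemma class_shift_comp: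
  assumes p: "p permutes {1..q}" and p': "p' permutes {1..q}" and x: "x \<in> carrier R"
  shows "class_shift p (class_shift p' x) = class_shift (p \<circ> p') x"
proof -
  let ?v = "residue x"
  have v: "?v \<in> {1..q}" "p' ?v \<in> {1..q}" "p (p' ?v) \<in> {1..q}"
    using residue_range[OF x] permutes_in_image[OF p] permutes_in_image[OF p'] by auto
  note cl = rep(1)[OF v(1)] rep(1)[OF v(2)] rep(1)[OF v(3)]
  show ?thesis
    unfolding class_shift_def[of p] class_shift_closed(2)[OF p' x]
    unfolding class_shift_def comp_def using translate_twice cl x by simp
qed

lemma class_shift_id: "x \<in> carrier R \<Longrightarrow> class_shift id x = x"
  using rep(1)[OF residue_range] by (simp add: class_shift_def a_minus_def r_neg)

lemma class_shift_bij:
  assumes "p permutes {1..q}" shows "bij_betw (class_shift p) (carrier R) (carrier R)"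
proof (rule bij_betw_byWitness[of _ "class_shift (inv' p)"])
  note p' = permutes_inv[OF assms]
  show "\<forall>x\<in>carrier R. class_shift (inv' p) (class_shift p x) = x"
    using class_shift_comp[OF p' assms] permutes_inv_o(2)[OF assms] class_shift_id by simp
  show "\<forall>x\<in>carrier R. class_shift p (class_shift (inv' p) x) = x"
    using class_shift_comp[OF assms p'] permutes_inv_o(1)[OF assms] class_shift_id by simp
  show "class_shift p ` carrier R \<subseteq> carrier R" "class_shift (inv' p) ` carrier R \<subseteq> carrier R"
    using class_shift_closed(1) assms p' by auto
qed

text \<open>The translation vectors are summed with the class indicators as weights; at each point
  only the summand of its own class survives.\<close>

lemma class_shift_poly:
  assumes "p permutes {1..q}" shows "poly_fun {1} (\<lambda>a. class_shift p (a (1::nat)))"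
proof -
  let ?s = "\<lambda>v. rep (p v) \<ominus> rep v"
  have s: "?s v \<in> carrier R" if "v \<in> {1..q}" for v
    using rep(1) permutes_in_image[OF assms, of v] that by simp
  have "poly_fun {1} (\<lambda>a. a (1::nat) \<oplus> (\<Oplus>v\<in>{1..q}. class_indicator (rep v) (a 1) \<otimes> ?s v))"
    by (intro poly_fun_add poly_fun_finsum poly_fun_mult poly_fun_var poly_fun_const
        poly_fun_class_indicator) (use s rep(1) in auto)
  then show ?thesis
  proof (rule poly_fun_cong)
    fix a assume "a \<in> {1::nat} \<rightarrow> carrier R"
    then have x: "a 1 \<in> carrier R" by simp
    have "(\<Oplus>v\<in>{1..q}. class_indicator (rep v) (a 1) \<otimes> ?s v)
      = (\<Oplus>v\<in>{1..q}. if residue (a 1) = v then ?s v else \<zero>)"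
    proof (intro finsum_cong' refl)
      fix v assume v: "v \<in> {1..q}"
      show "class_indicator (rep v) (a 1) \<otimes> ?s v = (if residue (a 1) = v then ?s v else \<zero>)"
        unfolding class_indicator[OF rep(1)[OF v] x] rep(2)[OF v] using s[OF v] by simp
    qed (use s in auto)
    also have "\<dots> = ?s (residue (a 1))"
      using s by (intro add.finprod_singleton residue_range x) auto
    finally show "a 1 \<oplus> (\<Oplus>v\<in>{1..q}. class_indicator (rep v) (a 1) \<otimes> ?s v) = class_shift p (a 1)"
      by (simp add: class_shift_def)
  qed
qed

lemma not_solvable_G: assumes "q \<ge> 5" shows "\<not> solvable G"
proof
  assume sol: "solvable G"
  let ?h = "\<lambda>p. first_map (class_shift p)"
  have hG: "?h p \<in> carrier G" if "p permutes {1..q}" for p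
    using first_map_in_G[OF class_shift_poly class_shift_bij] that by blast
  have "?h (p \<circ> p') = ?h p \<otimes>\<^bsub>G\<^esub> ?h p'" if "p permutes {1..q}" "p' permutes {1..q}" for p p'
    unfolding first_map_mult[OF hG[OF that(1)] hG[OF that(2)]]
    by (rule first_map_cong) (simp add: class_shift_comp[OF that])
  then interpret h: group_hom "sym_group q" G ?h
    by (intro group_hom.intro group_hom_axioms.intro sym_group_is_group group_G homI)
      (simp_all add: sym_group_carrier sym_group_mult hG)
  \<comment> \<open>The permutation is read off from the residues of the images of the
    representatives.\<close>
  have "inj_on ?h (carrier (sym_group q))"
  proof (rule inj_onI)
    fix p p' assume p: "p \<in> carrier (sym_group q)" and p': "p' \<in> carrier (sym_group q)"
      and eq: "?h p = ?h p'"
    have "p v = p' v" for v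
    proof (cases "v \<in> {1..q}")
      case True
      have "class_shift p (rep v) = class_shift p' (rep v)"
        by (rule first_map_eqD[OF eq rep(1)[OF True]])
      then show ?thesis
        using class_shift_closed(2)[of p "rep v"] class_shift_closed(2)[of p' "rep v"] p p' rep[OF True]
        by (simp add: sym_group_carrier)
    next
      case False
      then show ?thesis using p p' by (simp add: sym_group_carrier permutes_not_in)
    qed
    then show "p = p'" by (rule ext)
  qed
  then have "solvable (sym_group q)" using h.inj_hom_imp_solvable sol by blast
  then show False using sym_group_is_unsolvable[OF assms] by blast
qed

text \<open>Translation by \<open>1\<close> and scaling by a unit \<open>u\<close> commute at zero
  only if \<open>u = 1\<close>. As \<open>1 + x\<close> is a unit for \<open>x\<close> in
  \<open>M\<close>, this leaves only \<open>0\<close> and \<open>1\<close> in the ring.\<close>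

lemma comm_G_imp:
  assumes "comm_group G" shows "n = 1" "carrier R = {\<zero>, \<one>}"
proof -
  interpret Gc: comm_group G by fact
  have "u = \<one>" if u: "u \<in> Units R" for u
  proof -
    note t = translation_in_G[OF one_closed] and s = scaling_in_G[OF u]
    have "first_map (\<lambda>x. u \<otimes> (x \<oplus> \<one>)) = first_map (\<lambda>x. u \<otimes> x \<oplus> \<one>)"
      using Gc.m_comm[OF s t] unfolding first_map_mult[OF s t] first_map_mult[OF t s] .
    from first_map_eqD[OF this zero_closed] show ?thesis using u Units_closed by simp
  qed
  note units = this
  show "carrier R = {\<zero>, \<one>}"
  proof (intro equalityI subsetI)
    fix x assume x: "x \<in> carrier R"
    show "x \<in> {\<zero>, \<one>}"
    proof (cases "x \<in> M")
      case True
      have "\<one> \<oplus> x \<ominus> \<one> = x" using x by algebra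
      then have "\<one> \<oplus> x \<in> Units R" using Units_if_diff[of "\<one> \<oplus> x" \<one>] True x by simp
      then have "\<one> \<oplus> x = \<one>" using units by blast
      then show ?thesis using x by simp
    next
      case False
      then show ?thesis using units Units_iff x by blast
    qed
  qed auto
  show "n = 1"
  proof (rule ccontr)
    assume "n \<noteq> 1"
    then have n: "2 \<in> {1..n}" "1 \<in> {1..n}" using n_ge_1 by auto
    \<comment> \<open>The shear that adds the first coordinate to the second. At the origin,
      translating the first coordinate before it gives \<open>1\<close> in the second coordinate,
      translating afterwards gives \<open>0\<close>.\<close>
    define h where "h i = (if i = 2 then (\<lambda>a. a 1 \<oplus> a 2) else (\<lambda>a. a i))" for i :: nat
    have "MT_coord i (h i)" if "i \<in> {1..n}" for i
    proof (cases "i = 2")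
      case True
      show ?thesis
      proof (rule MT_coord_Suc[of i "\<lambda>a. a 1" "\<lambda>_. \<one>"])
        fix a assume "a \<in> {1..i} \<rightarrow> carrier R"
        then have "a i \<in> carrier R" using True by auto
        then show "h i a = a 1 \<oplus> a i \<otimes> \<one>" using True by (simp add: h_def)
      qed (use True in \<open>auto intro: poly_fun_var poly_fun_const\<close>)
    next
      case False
      then show ?thesis using MT_coord_id[of i] that by (simp add: h_def)
    qed
    note coords = this
    have g: "(\<lambda>a\<in>points R n. \<lambda>i\<in>{1..n}. h i a) \<in> carrier G" (is "?g \<in> _")
      unfolding carrier_G MT_maps_def by (intro CollectI exI[of _ h] conjI ballI coords refl)
    let ?t = "first_map (\<lambda>x. x \<oplus> \<one>)" and ?z = "diagonal_point \<zero>"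
    note t = translation_in_G[OF one_closed]
    have z: "?z \<in> points R n" by (rule diagonal_point[OF zero_closed])
    have "?g (?t ?z) = ?t (?g ?z)"
      using Gc.m_comm[OF g t] z unfolding G_mult[OF g t] G_mult[OF t g] compose_def
      by (metis (no_types, lifting) restrict_apply')
    moreover have "?t ?z \<in> points R n" "?g ?z \<in> points R n"
      using MT_maps_into[OF _ z] g t unfolding carrier_G by blast+
    moreover have "?t ?z = ?z(1 := \<zero> \<oplus> \<one>)" using z n by (simp add: first_map_def diagonal_point_def)
    ultimately have "?g (?z(1 := \<one>)) 2 = ?t (?g ?z) 2" "?z(1 := \<one>) \<in> points R n" by simp_all
    moreover have "?t (?g ?z) 2 = ?g ?z 2" using \<open>?g ?z \<in> points R n\<close> by (simp add: first_map_def)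
    ultimately have "\<one> \<oplus> \<zero> = \<zero> \<oplus> \<zero>" using z n by (simp add: h_def diagonal_point_def)
    then show False using one_notin_M by simp
  qed
qed

text \<open>There are at most two points, and permutations of two points commute. The cases rest on
  \<open>small\<close>: among any three points two coincide.\<close>

lemma comm_G:
  assumes "n = 1" "card (carrier R) \<le> 2" shows "comm_group G"
proof (rule group.group_comm_groupI[OF group_G])
  fix g h assume g: "g \<in> carrier G" and h: "h \<in> carrier G"
  have "card (points R n) = card (carrier R)"
    unfolding points_def using assms(1) by (simp add: card_PiE)
  then have "card (points R n) \<le> 2" using assms(2) by simp
  then have small: "a = b \<or> b = c \<or> a = c"
    if "a \<in> points R n" "b \<in> points R n" "c \<in> points R n" for a b c
    using card_mono[OF finite_points, of "{a, b, c}"] that by (cases "a = b \<or> b = c \<or> a = c") auto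
  have into: "g a \<in> points R n" "h a \<in> points R n" if "a \<in> points R n" for a
    using g h that MT_maps_into unfolding carrier_G by auto
  have inj: "g a = g b \<longleftrightarrow> a = b" "h a = h b \<longleftrightarrow> a = b"
    if "a \<in> points R n" "b \<in> points R n" for a b
    using inj_on_eq_iff[OF MT_maps_inj] g h that unfolding carrier_G by blast+
  have "g (h a) = h (g a)" if a: "a \<in> points R n" for a
  proof (cases "g a = a")
    case True
    show ?thesis
    proof (cases "h a = a")
      case False
      then have "g (h a) = h a"
        using small[OF a into(2)[OF a] into(1)[OF into(2)[OF a]]] inj(1)[OF into(2)[OF a] a] True by metis
      then show ?thesis using True by simp
    qed (use True in simp)
  next
    case False
    note ga = into(1)[OF a] and ha = into(2)[OF a]
    have gga: "g (g a) = a" using small[OF a ga into(1)[OF ga]] inj(1)[OF ga a] False by metis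
    show ?thesis
    proof (cases "h a = a")
      case True
      then have "h (g a) = g a" using small[OF a ga into(2)[OF ga]] inj(2)[OF ga a] False by metis
      then show ?thesis using True by simp
    next
      case ha': False
      then have "h a = g a" using small[OF a ga ha] False by metis
      moreover have "h (h a) = a" using small[OF a ha into(2)[OF ha]] inj(2)[OF ha a] ha' by metis
      ultimately show ?thesis using gga by metis
    qed
  qed
  then show "g \<otimes>\<^bsub>G\<^esub> h = h \<otimes>\<^bsub>G\<^esub> g"
    unfolding G_mult[OF g h] G_mult[OF h g] compose_def by (intro restrict_ext) simp
qed

end

lemma card_ZFact_2: "card (carrier (ZFact 2)) \<le> 2"
proof -
  have "carrier (ZFact 2) \<subseteq> {ZMod 2 0, ZMod 2 1}"
  proof
    fix Y assume "Y \<in> carrier (ZFact 2)"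
    then obtain k where "Y = ZMod 2 k"
      unfolding ZFact_def FactRing_def A_RCOSETS_def' ZMod_def by auto
    then have "Y = ZMod 2 (k mod 2)" using ZMod_mod by simp
    moreover have "k mod 2 = 0 \<or> k mod 2 = 1" by auto
    ultimately show "Y \<in> {ZMod 2 0, ZMod 2 1}" by auto
  qed
  then have "card (carrier (ZFact 2)) \<le> card {ZMod 2 0, ZMod 2 1}"
    by (rule card_mono[rotated]) simp
  also have "\<dots> \<le> 2" by (simp add: card_insert_if)
  finally show ?thesis .
qed

text \<open>Parity maps the integers onto the ring with the even numbers as kernel. It is additive
  because \<open>1 + 1 = 1\<close> would give \<open>1 = 0\<close>, which leaves
  \<open>1 + 1 = 0\<close>.\<close>

lemma (in ring) iso_ZFact_2:
  assumes R: "carrier R = {\<zero>, \<one>}" and neq: "\<one> \<noteq> \<zero>" shows "R \<simeq> ZFact 2"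
proof -
  have two: "\<one> \<oplus> \<one> = \<zero>"
  proof -
    have "\<one> \<oplus> \<one> \<in> {\<zero>, \<one>}" using R add.m_closed one_closed by metis
    moreover have "\<one> \<oplus> \<one> \<noteq> \<one>" using neq by simp
    ultimately show ?thesis by blast
  qed
  define h where "h k = (if even k then \<zero> else \<one>)" for k :: int
  have "h \<in> ring_hom \<Z> R"
    by (rule ring_hom_memI) (auto simp: h_def two)
  then interpret h: ring_hom_ring \<Z> R h
    by (intro ring_hom_ringI2 int.ring_axioms ring_axioms)
  have "h ` carrier \<Z> = carrier R"
  proof -
    have "h 0 = \<zero>" "h 1 = \<one>" by (simp_all add: h_def)
    then show ?thesis unfolding R by (auto simp: h_def intro: rev_image_eqI[of 0] rev_image_eqI[of 1])
  qed
  moreover have "a_kernel \<Z> R h = Idl\<^bsub>\<Z>\<^esub> {2}"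
    unfolding a_kernel_def' int_Idl using neq by (auto simp: h_def elim!: evenE)
  ultimately have "ZFact 2 \<simeq> R" using h.FactRing_iso by (simp add: ZFact_def)
  then show ?thesis using ring_iso_sym cring.axioms(1)[OF ZFact_is_cring] by blast
qed

theorem theorem4p21:
  fixes R :: "('a, 'm) ring_scheme" and n q :: nat
  assumes "n \<ge> 1"
    and "local_ring R"
    and "finite (carrier R)"
    and "q = order (residue_field R)"
  shows "(solvable (MT_perms R n) \<longleftrightarrow> q \<le> 4) \<and>
         (nilpotent_group (MT_perms R n) \<longleftrightarrow> q = 2) \<and>
         (comm_group (MT_perms R n) \<longleftrightarrow> n = 1 \<and> R \<simeq> ZFact 2)"
proof -
  define M where "M = (THE M. maximalideal M R)"
  have ex1: "\<exists>!M. maximalideal M R" and "cring R" using assms(2) by (auto simp: local_ring_def)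
  have max: "maximalideal M R" unfolding M_def by (rule theI'[OF ex1])
  interpret MT_setting R M n
    using assms(1,3) \<open>cring R\<close> max ex1
    by (intro MT_setting.intro finite_local_ring.intro finite_local_ring_axioms.intro
        MT_setting_axioms.intro) auto
  have qq: "q = finite_local_ring.q R M"
    using assms(4) by (simp add: residue_field_def M_def[symmetric] q_def)
  have "solvable (MT_perms R n) \<longleftrightarrow> q \<le> 4"
    using solvable_G not_solvable_G unfolding qq by linarith
  \<comment> \<open>A residue field has at least two elements, so excluding \<open>q \<ge> 3\<close>
    leaves \<open>q = 2\<close>.\<close>
  moreover have "nilpotent_group (MT_perms R n) \<longleftrightarrow> q = 2"
    using nilpotent_G not_nilpotent_G q_ge_2 unfolding qq by linarith
  moreover have "n = 1 \<and> R \<simeq> ZFact 2" if "comm_group (MT_perms R n)"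
    using comm_G_imp[OF that] iso_ZFact_2 one_notin_M M.zero_closed by metis
  moreover have "comm_group (MT_perms R n)" if n1: "n = 1" and iso: "R \<simeq> ZFact 2"
  proof (rule comm_G[OF n1])
    obtain f where "bij_betw f (carrier R) (carrier (ZFact 2))"
      using iso by (auto simp: is_ring_iso_def ring_iso_def)
    then show "card (carrier R) \<le> 2" using bij_betw_same_card card_ZFact_2 by metis
  qed
  ultimately show ?thesis by blast
qed

end
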